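(* Let $n\ge 2$, let $\Omega\subset\mathbb{R}^n$ be a domain (a nonempty connected open set), let $A$ be a constant with $0<A\le 2$, and let $G:\mathbb{R}\to\mathbb{R}$ be a smooth function satisfying $G>0$, $G'<0$ and $G\,G''\le A\,(G')^2$. Let $u:\Omega\to\mathbb{R}$ be a smooth convex solution of $\Delta u=G(u)$ in $\Omega$. If the function $x\mapsto \sigma_2(D^2u(x))$ has a local minimum at some point of $\Omega$, then $D^2u(x)$ has rank $1$ for every $x\in\Omega$.
   Context: $D^2u$ denotes the Hessian matrix of $u$, and $\Delta u$ its trace. $G'$ and $G''$ denote the first and second derivatives of the one-variable function $G$. For a symmetric $n\times n$ matrix $M$ with eigenvalues $\lambda_1,\dots,\lambda_n$, $\sigma_2(M)=\sum_{1\le i<j\le n}\lambda_i\lambda_j$ is the second elementary symmetric polynomial of the eigenvalues. Convexity of $u$ on $\Omega$ (which need not be a convex set) means that $D^2u(x)$ is positive semidefinite for every $x\in\Omega$. A local minimum is not assumed to be strict. *)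

theory Defs
  imports "HOL-Analysis.Analysis" "HOL-Computational_Algebra.Polynomial"
begin

text \<open>Functions on a domain are total functions of which only the values on the (open) domain are
  used; \<open>smooth_on\<close> is meant for open sets, where \<open>frechet_derivative f (at x)\<close> depends only on the
  values near \<open>x\<close>.\<close>

primrec Ck_on :: "nat \<Rightarrow> 'a::real_normed_vector set \<Rightarrow> ('a \<Rightarrow> 'b::real_normed_vector) \<Rightarrow> bool" where
  "Ck_on 0 S f \<longleftrightarrow> continuous_on S f"
| "Ck_on (Suc k) S f \<longleftrightarrow>
     (\<forall>x\<in>S. f differentiable (at x)) \<and> (\<forall>v. Ck_on k S (\<lambda>x. frechet_derivative f (at x) v))"

definition smooth_on :: "'a::real_normed_vector set \<Rightarrow> ('a \<Rightarrow> 'b::real_normed_vector) \<Rightarrow> bool" where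
  "smooth_on S f \<longleftrightarrow> (\<forall>k. Ck_on k S f)"

definition partial_deriv :: "'n::finite \<Rightarrow> (real^'n \<Rightarrow> real) \<Rightarrow> real^'n \<Rightarrow> real" where
  "partial_deriv i u x = frechet_derivative u (at x) (axis i 1)"

definition hessian :: "(real^'n::finite \<Rightarrow> real) \<Rightarrow> real^'n \<Rightarrow> real^'n^'n" where
  "hessian u x = (\<chi> i j. partial_deriv i (partial_deriv j u) x)"

definition laplacian :: "(real^'n::finite \<Rightarrow> real) \<Rightarrow> real^'n \<Rightarrow> real" where
  "laplacian u x = trace (hessian u x)"

definition positive_semidefinite :: "real^'n::finite^'n \<Rightarrow> bool" where
  "positive_semidefinite M \<longleftrightarrow> transpose M = M \<and> (\<forall>v. 0 \<le> v \<bullet> (M *v v))"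

definition charpoly :: "real^'n::finite^'n \<Rightarrow> real poly" where
  "charpoly M = det (mat [:0, 1:] - (\<chi> i j. [:M $ i $ j:]))"

text \<open>The real eigenvalues with algebraic multiplicity, in increasing order; for symmetric
  \<open>M\<close> these are all the eigenvalues, so the list has length \<open>CARD('n)\<close>.\<close>

definition eigenvalues :: "real^'n::finite^'n \<Rightarrow> real list" where
  "eigenvalues M = sorted_list_of_multiset (proots (charpoly M))"

definition sigma2 :: "real^'n::finite^'n \<Rightarrow> real" where
  "sigma2 M = (let l = eigenvalues M in \<Sum>j<length l. \<Sum>i<j. l ! i * l ! j)"

end

theory Submission
  imports Defs
begin

text \<open>
Write \<open>H\<close> for the Hessian of \<open>u\<close> and \<open>g\<close> for \<open>G \<circ> u\<close>. The function \<open>\<phi> = (tr H)\<^sup>2 - |H|\<^sup>2\<close> is twice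
the second elementary symmetric polynomial of the eigenvalues, and it is polynomial in second
derivatives of \<open>u\<close>, hence smooth. Since \<open>H\<close> is positive semidefinite with trace \<open>g > 0\<close>, always
\<open>\<phi> \<ge> 0\<close>, and \<open>\<phi> = 0\<close> holds exactly where a single eigenvalue is nonzero, that is where \<open>H\<close> has
rank one. So it suffices to show that \<open>\<phi>\<close> vanishes identically.

The heart of the matter is the differential inequality of \<open>laplacian_hessian_defect_le\<close>:
\<open>\<Delta>\<phi> \<le> 2 G'(u) \<phi> + K |\<nabla>\<phi>|\<close> with a continuous coefficient \<open>K\<close>. At a given point take an
orthonormal frame that diagonalizes \<open>H\<close>, with eigenvalues \<open>l\<^sub>k\<close>. Differentiating the equation
\<open>\<Delta>u = G(u)\<close> twice gives \<open>\<Delta>\<phi> / 2 = \<Sum>\<^sub>k (G'\<^sup>2 u\<^sub>k\<^sup>2 + (g - l\<^sub>k) G'' u\<^sub>k\<^sup>2) + G' \<phi> - |D\<^sup>3 u|\<^sup>2\<close>. By the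
hypothesis on \<open>G''\<close> with \<open>A \<le> 2\<close>, the sum is at most \<open>\<Sum>\<^sub>k g\<^sub>k\<^sup>2 (3 - 2 l\<^sub>k / g)\<close>, where
\<open>g\<^sub>k = G' u\<^sub>k\<close>. On the other side, counting the three positions of the distinguished index,
\<open>|D\<^sup>3 u|\<^sup>2\<close> is at least \<open>\<Sum>\<^sub>k (u\<^sub>k\<^sub>k\<^sub>k\<^sup>2 + 3 \<Sum>\<^sub>a\<^sub>\<noteq>\<^sub>k u\<^sub>k\<^sub>a\<^sub>a\<^sup>2)\<close>. The gradient of \<open>\<phi>\<close> enters through
\<open>\<Sum>\<^sub>a l\<^sub>a u\<^sub>k\<^sub>a\<^sub>a = g g\<^sub>k - \<phi>\<^sub>k / 2\<close>: when \<open>\<phi>\<^sub>k\<close> is small, the Cauchy-Schwarz inequality with weights \<open>1\<close>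
and \<open>3\<close> forces the third derivatives to be large, and the resulting one-variable inequality
(\<open>cubic_eigenvalue_inequality\<close>) says precisely that they absorb \<open>g\<^sub>k\<^sup>2 (3 - 2 l\<^sub>k / g)\<close>, up to a
multiple of \<open>|\<phi>\<^sub>k|\<close>.

Because \<open>G' \<phi> \<le> 0\<close>, the inequality yields \<open>\<Delta>\<phi> \<le> C |\<nabla>\<phi>|\<close> on small balls, so Hopf's strong minimum
principle (\<open>strong_minimum_principle\<close>) makes \<open>\<phi>\<close> constant near each local minimum. Then \<open>\<Delta>\<phi> = 0\<close>
and \<open>\<nabla>\<phi> = 0\<close> there, and the strict sign of \<open>G'\<close> in the differential inequality gives \<open>\<phi> = 0\<close>.
Finally every zero of \<open>\<phi>\<close> is itself a local minimum, hence the zero set is open; it is also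
closed in \<open>\<Omega>\<close> and nonempty, and \<open>\<Omega>\<close> is connected.
\<close>

section \<open>Directional derivatives and smooth functions\<close>

definition dir_deriv :: "'a::real_normed_vector \<Rightarrow> ('a \<Rightarrow> 'b::real_normed_vector) \<Rightarrow> 'a \<Rightarrow> 'b" where
  "dir_deriv v f x = frechet_derivative f (at x) v"

lemma dir_deriv_eqI: "(f has_derivative f') (at x) \<Longrightarrow> dir_deriv v f x = f' v"
  unfolding dir_deriv_def by (metis frechet_derivative_at)

lemma dir_deriv_cong:
  assumes "open S" "x \<in> S" "\<And>y. y \<in> S \<Longrightarrow> f y = g y"
  shows "dir_deriv v f x = dir_deriv v g x"
proof -
  have "(f has_derivative D) (at x) = (g has_derivative D) (at x)" for D
    using assms by (metis has_derivative_transform_within_open)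
  then show ?thesis
    by (simp add: dir_deriv_def frechet_derivative_def)
qed

lemma differentiable_cong_open:
  assumes "open S" "x \<in> S" "\<And>y. y \<in> S \<Longrightarrow> f y = g y" "f differentiable (at x)"
  shows "g differentiable (at x)"
  using assms by (metis differentiable_def has_derivative_transform_within_open)

lemma dir_deriv_lin:
  fixes f :: "'a::real_normed_vector \<Rightarrow> 'b::real_normed_vector"
  assumes "f differentiable (at x)"
  shows "linear (\<lambda>v. dir_deriv v f x)"
  using linear_frechet_derivative[OF assms] by (simp add: dir_deriv_def)

lemma dir_deriv_add:
  assumes "f differentiable (at x)" "g differentiable (at x)"
  shows "dir_deriv v (\<lambda>y. f y + g y) x = dir_deriv v f x + dir_deriv v g x"
  using assms unfolding frechet_derivative_works
  by (subst dir_deriv_eqI[OF has_derivative_add]) (auto simp: dir_deriv_def)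

lemma dir_deriv_mult:
  fixes f g :: "'a::real_normed_vector \<Rightarrow> real"
  assumes "f differentiable (at x)" "g differentiable (at x)"
  shows "dir_deriv v (\<lambda>y. f y * g y) x = dir_deriv v f x * g x + f x * dir_deriv v g x"
  using assms unfolding frechet_derivative_works
  by (subst dir_deriv_eqI[OF has_derivative_mult]) (auto simp: dir_deriv_def)

lemma dir_deriv_const: "dir_deriv v (\<lambda>y. c) x = 0"
  by (simp add: dir_deriv_def)

lemma Ck_on_dir_deriv: "Ck_on (Suc k) S f \<Longrightarrow> Ck_on k S (dir_deriv v f)"
  by (simp add: dir_deriv_def[abs_def])

lemma Ck_on_SucI:
  "(\<And>x. x \<in> S \<Longrightarrow> f differentiable (at x)) \<Longrightarrow> (\<And>v. Ck_on k S (dir_deriv v f)) \<Longrightarrow> Ck_on (Suc k) S f"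
  by (simp add: dir_deriv_def[abs_def])

lemma Ck_on_differentiable: "Ck_on (Suc k) S f \<Longrightarrow> x \<in> S \<Longrightarrow> f differentiable (at x)"
  by simp

lemma Ck_on_cong:
  assumes "open S" "\<And>y. y \<in> S \<Longrightarrow> f y = g y" "Ck_on k S f"
  shows "Ck_on k S g"
  using assms(2,3)
proof (induction k arbitrary: f g)
  case 0
  then show ?case
    using continuous_on_cong[of S S f g] by simp
next
  case (Suc k)
  show ?case
  proof (rule Ck_on_SucI)
    show "g differentiable (at x)" if "x \<in> S" for x
      using differentiable_cong_open[OF assms(1) that, of f g] Suc.prems that by simp
    show "Ck_on k S (dir_deriv v g)" for v
      using Suc.IH[OF _ Ck_on_dir_deriv[OF Suc.prems(2)]]
        dir_deriv_cong[OF assms(1), of _ f g] Suc.prems(1) by blast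
  qed
qed

lemma Ck_on_lower: "Ck_on (Suc k) S f \<Longrightarrow> Ck_on k S f"
proof (induction k arbitrary: f)
  case 0
  then have "f differentiable_on S"
    by (auto simp: differentiable_on_def intro: differentiable_at_withinI)
  then show ?case
    by (simp add: differentiable_imp_continuous_on)
next
  case (Suc k)
  show ?case
    using Suc.IH[OF Ck_on_dir_deriv[OF Suc.prems]] Suc.prems by (intro Ck_on_SucI) simp_all
qed

lemma Ck_on_add:
  assumes "open S"
  shows "Ck_on k S f \<Longrightarrow> Ck_on k S g \<Longrightarrow> Ck_on k S (\<lambda>x. f x + g x)"
proof (induction k arbitrary: f g)
  case 0
  then show ?case by (auto intro: continuous_intros)
next
  case (Suc k)
  note d = Ck_on_differentiable[OF Suc.prems(1)] Ck_on_differentiable[OF Suc.prems(2)]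
  show ?case
  proof (rule Ck_on_SucI)
    show "Ck_on k S (dir_deriv v (\<lambda>x. f x + g x))" for v
      by (rule Ck_on_cong[OF assms _ Suc.IH[OF Suc.prems[THEN Ck_on_dir_deriv[of _ _ _ v]]]])
        (simp add: dir_deriv_add d)
  qed (use d in auto)
qed

text \<open>By the product rule a derivative of \<open>f g\<close> is \<open>f' g + f g'\<close>, to whose two products the
  induction hypothesis applies because the undifferentiated factors are also of class \<open>C\<^sup>k\<close>.\<close>

lemma Ck_on_mult:
  fixes f g :: "'a::real_normed_vector \<Rightarrow> real"
  assumes "open S"
  shows "Ck_on k S f \<Longrightarrow> Ck_on k S g \<Longrightarrow> Ck_on k S (\<lambda>x. f x * g x)"
proof (induction k arbitrary: f g)
  case 0
  then show ?case by (auto intro: continuous_intros)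
next
  case (Suc k)
  note d = Ck_on_differentiable[OF Suc.prems(1)] Ck_on_differentiable[OF Suc.prems(2)]
  show ?case
  proof (rule Ck_on_SucI)
    show "Ck_on k S (dir_deriv v (\<lambda>x. f x * g x))" for v
      by (rule Ck_on_cong[OF assms _ Ck_on_add[OF assms
              Suc.IH[OF Ck_on_dir_deriv[OF Suc.prems(1)] Ck_on_lower[OF Suc.prems(2)]]
              Suc.IH[OF Ck_on_lower[OF Suc.prems(1)] Ck_on_dir_deriv[OF Suc.prems(2)]]]])
        (simp add: dir_deriv_mult d)
  qed (use d in auto)
qed

lemma Ck_on_const: "Ck_on k S (\<lambda>x. c)"
  by (induction k arbitrary: c) auto

lemma smooth_on_dir_deriv: "smooth_on S f \<Longrightarrow> smooth_on S (dir_deriv v f)"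
  unfolding smooth_on_def by (blast intro: Ck_on_dir_deriv)

lemma smooth_on_differentiable: "smooth_on S f \<Longrightarrow> x \<in> S \<Longrightarrow> f differentiable (at x)"
  unfolding smooth_on_def by (meson Ck_on_differentiable)

lemma smooth_on_continuous: "smooth_on S f \<Longrightarrow> continuous_on S f"
  unfolding smooth_on_def by (metis Ck_on.simps(1))

lemma smooth_on_cong:
  "open S \<Longrightarrow> (\<And>y. y \<in> S \<Longrightarrow> f y = g y) \<Longrightarrow> smooth_on S f \<Longrightarrow> smooth_on S g"
  unfolding smooth_on_def by (meson Ck_on_cong)

lemma Ck_on_subset: "Ck_on k S f \<Longrightarrow> T \<subseteq> S \<Longrightarrow> Ck_on k T f"
  by (induction k arbitrary: f) (auto intro: continuous_on_subset)

lemma smooth_on_subset: "smooth_on S f \<Longrightarrow> T \<subseteq> S \<Longrightarrow> smooth_on T f"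
  unfolding smooth_on_def by (meson Ck_on_subset)

lemma smooth_on_add:
  "open S \<Longrightarrow> smooth_on S f \<Longrightarrow> smooth_on S g \<Longrightarrow> smooth_on S (\<lambda>x. f x + g x)"
  by (simp add: smooth_on_def Ck_on_add)

lemma smooth_on_mult:
  fixes f g :: "'a::real_normed_vector \<Rightarrow> real"
  shows "open S \<Longrightarrow> smooth_on S f \<Longrightarrow> smooth_on S g \<Longrightarrow> smooth_on S (\<lambda>x. f x * g x)"
  by (simp add: smooth_on_def Ck_on_mult)

lemma smooth_on_const: "smooth_on S (\<lambda>x. c)"
  by (simp add: smooth_on_def Ck_on_const)

lemma smooth_on_diff:
  fixes f g :: "'a::real_normed_vector \<Rightarrow> real"
  assumes "open S" "smooth_on S f" "smooth_on S g"
  shows "smooth_on S (\<lambda>x. f x - g x)"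
  using smooth_on_add[OF assms(1,2) smooth_on_mult[OF assms(1) smooth_on_const[of S "-1"] assms(3)]]
  by simp

lemma smooth_on_sum:
  fixes f :: "'i \<Rightarrow> 'a::real_normed_vector \<Rightarrow> real"
  assumes "open S" "\<And>i. i \<in> I \<Longrightarrow> smooth_on S (f i)"
  shows "smooth_on S (\<lambda>x. \<Sum>i\<in>I. f i x)"
  using assms(2)
  by (induction I rule: infinite_finite_induct)
    (auto simp: smooth_on_const intro!: smooth_on_add[OF assms(1)])

lemma dir_deriv_sum:
  fixes f :: "'i \<Rightarrow> 'a::real_normed_vector \<Rightarrow> real"
  assumes "\<And>i. i \<in> I \<Longrightarrow> f i differentiable (at x)"
  shows "dir_deriv v (\<lambda>y. \<Sum>i\<in>I. f i y) x = (\<Sum>i\<in>I. dir_deriv v (f i) x)"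
  using assms unfolding frechet_derivative_works
  by (subst dir_deriv_eqI[OF has_derivative_sum]) (auto simp: dir_deriv_def)

lemma dir_deriv_diff:
  assumes "f differentiable (at x)" "g differentiable (at x)"
  shows "dir_deriv v (\<lambda>y. f y - g y) x = dir_deriv v f x - dir_deriv v g x"
  using assms unfolding frechet_derivative_works
  by (subst dir_deriv_eqI[OF has_derivative_diff]) (auto simp: dir_deriv_def)

lemma dir_deriv_compose_real:
  fixes h :: "real \<Rightarrow> real" and f :: "'a::real_normed_vector \<Rightarrow> real"
  assumes "f differentiable (at x)" "h differentiable (at (f x))"
  shows "dir_deriv v (\<lambda>y. h (f y)) x = deriv h (f x) * dir_deriv v f x"
    and "(\<lambda>y. h (f y)) differentiable (at x)"
proof -
  have h: "(h has_derivative (*) (deriv h (f x))) (at (f x))"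
    using assms(2) DERIV_deriv_iff_real_differentiable has_field_derivative_def by blast
  have f: "(f has_derivative (\<lambda>v. dir_deriv v f x)) (at x)"
    using assms(1) unfolding frechet_derivative_works dir_deriv_def by simp
  note hf = has_derivative_compose[OF f h]
  show "dir_deriv v (\<lambda>y. h (f y)) x = deriv h (f x) * dir_deriv v f x"
    by (rule dir_deriv_eqI[OF hf])
  show "(\<lambda>y. h (f y)) differentiable (at x)"
    using hf differentiable_def by blast
qed

lemma deriv_eq_dir_deriv:
  fixes h :: "real \<Rightarrow> real"
  assumes "h differentiable (at t)"
  shows "deriv h t = dir_deriv 1 h t"
proof -
  have h: "(h has_derivative (*) (deriv h t)) (at t)"
    using assms DERIV_deriv_iff_real_differentiable has_field_derivative_def by blast
  show ?thesis by (simp add: dir_deriv_eqI[OF h])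
qed

lemma smooth_on_deriv:
  fixes h :: "real \<Rightarrow> real"
  assumes "smooth_on UNIV h"
  shows "smooth_on UNIV (deriv h)"
  using smooth_on_cong[OF open_UNIV deriv_eq_dir_deriv[symmetric] smooth_on_dir_deriv[OF assms]]
    smooth_on_differentiable[OF assms] by blast

lemma DERIV_along_line:
  fixes f :: "'a::real_normed_vector \<Rightarrow> real"
  assumes "f differentiable (at (x + t *\<^sub>R v))"
  shows "((\<lambda>s. f (x + s *\<^sub>R v)) has_real_derivative dir_deriv v f (x + t *\<^sub>R v)) (at t)"
proof -
  have f: "(f has_derivative (\<lambda>w. dir_deriv w f (x + t *\<^sub>R v))) (at (x + t *\<^sub>R v))"
    using assms unfolding frechet_derivative_works dir_deriv_def by simp
  have l: "((\<lambda>s. x + s *\<^sub>R v) has_derivative (\<lambda>s. s *\<^sub>R v)) (at t)"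
    by (auto intro!: derivative_eq_intros)
  show ?thesis
    unfolding has_field_derivative_def
    by (rule has_derivative_eq_rhs[OF has_derivative_compose[OF l f]])
      (auto simp: linear_cmul[OF dir_deriv_lin[OF assms]] mult.commute)
qed

text \<open>Two applications of the mean value theorem, first in direction \<open>a\<close> to the difference of \<open>f\<close>
  across the step \<open>h b\<close>, then in direction \<open>b\<close> to \<open>D\<^sub>a f\<close>.\<close>

lemma second_difference_mean_value:
  fixes f :: "'a::real_normed_vector \<Rightarrow> real"
  assumes "smooth_on S f" "0 < h"
    and inS: "\<And>s t. 0 \<le> s \<Longrightarrow> s \<le> h \<Longrightarrow> 0 \<le> t \<Longrightarrow> t \<le> h \<Longrightarrow> x + s *\<^sub>R a + t *\<^sub>R b \<in> S"
  shows "\<exists>s t. 0 < s \<and> s < h \<and> 0 < t \<and> t < h \<and>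
    f (x + h *\<^sub>R a + h *\<^sub>R b) - f (x + h *\<^sub>R a) - f (x + h *\<^sub>R b) + f x
       = h\<^sup>2 * dir_deriv b (dir_deriv a f) (x + s *\<^sub>R a + t *\<^sub>R b)"
proof -
  have dS: "g differentiable (at (x + s *\<^sub>R a + t *\<^sub>R b))"
    if "0 \<le> s" "s \<le> h" "0 \<le> t" "t \<le> h" "smooth_on S g" for s t and g :: "'a \<Rightarrow> real"
    using smooth_on_differentiable[OF that(5) inS] that by blast
  define \<phi> where "\<phi> = (\<lambda>s. f ((x + h *\<^sub>R b) + s *\<^sub>R a) - f (x + s *\<^sub>R a))"
  have d\<phi>: "(\<phi> has_real_derivative
      (dir_deriv a f ((x + h *\<^sub>R b) + s *\<^sub>R a) - dir_deriv a f (x + s *\<^sub>R a))) (at s)"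
    if "0 \<le> s" "s \<le> h" for s
    unfolding \<phi>_def
    using dS[of s h f] dS[of s 0 f] that assms
    by (intro DERIV_diff DERIV_along_line) (auto simp: algebra_simps)
  obtain s where s: "0 < s" "s < h"
    "\<phi> h - \<phi> 0 = (h - 0) * (dir_deriv a f ((x + h *\<^sub>R b) + s *\<^sub>R a) - dir_deriv a f (x + s *\<^sub>R a))"
    using MVT2[OF assms(2) d\<phi>] by auto
  define \<psi> where "\<psi> = (\<lambda>t. dir_deriv a f ((x + s *\<^sub>R a) + t *\<^sub>R b))"
  have d\<psi>: "(\<psi> has_real_derivative dir_deriv b (dir_deriv a f) ((x + s *\<^sub>R a) + t *\<^sub>R b)) (at t)"
    if "0 \<le> t" "t \<le> h" for t
    unfolding \<psi>_def
    using dS[of s t "dir_deriv a f"] that s smooth_on_dir_deriv[OF assms(1), of a]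
    by (intro DERIV_along_line) auto
  obtain t where t: "0 < t" "t < h"
    "\<psi> h - \<psi> 0 = (h - 0) * dir_deriv b (dir_deriv a f) ((x + s *\<^sub>R a) + t *\<^sub>R b)"
    using MVT2[OF assms(2) d\<psi>] by auto
  have "f (x + h *\<^sub>R a + h *\<^sub>R b) - f (x + h *\<^sub>R a) - f (x + h *\<^sub>R b) + f x = \<phi> h - \<phi> 0"
    by (simp add: \<phi>_def algebra_simps)
  also have "\<dots> = h * (\<psi> h - \<psi> 0)"
    using s(3) by (simp add: \<psi>_def algebra_simps)
  finally show ?thesis
    using s(1,2) t by (intro exI[of _ s] exI[of _ t]) (simp add: power2_eq_square)
qed

text \<open>The second difference of \<open>f\<close> is symmetric in \<open>a\<close> and \<open>b\<close>, so the mean value lemma computes the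
  same number in both orders of differentiation, at points that tend to \<open>x\<close>; continuity of the
  second derivatives does the rest.\<close>

lemma dir_deriv_commute:
  fixes f :: "'a::real_normed_vector \<Rightarrow> real"
  assumes "open S" "smooth_on S f" "x \<in> S"
  shows "dir_deriv a (dir_deriv b f) x = dir_deriv b (dir_deriv a f) x"
proof -
  let ?L = "dir_deriv b (dir_deriv a f)" and ?R = "dir_deriv a (dir_deriv b f)"
  have cont: "isCont ?L x" "isCont ?R x"
    using assms by (auto intro!: continuous_on_interior smooth_on_continuous smooth_on_dir_deriv
        simp: interior_open)
  have "dist (?L x) (?R x) \<le> 2 * e" if e: "e > 0" for e
  proof -
    obtain d1 where d1: "d1 > 0" "\<And>y. dist y x < d1 \<Longrightarrow> dist (?L y) (?L x) < e"
      using cont(1) e unfolding continuous_at_eps_delta by blast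
    obtain d2 where d2: "d2 > 0" "\<And>y. dist y x < d2 \<Longrightarrow> dist (?R y) (?R x) < e"
      using cont(2) e unfolding continuous_at_eps_delta by blast
    obtain d3 where d3: "d3 > 0" "ball x d3 \<subseteq> S"
      using assms openE by blast
    define d where "d = min d1 (min d2 d3)"
    define h where "h = d / 2 / (norm a + norm b + 1)"
    have dp: "d > 0" using d1 d2 d3 by (simp add: d_def)
    have pos: "norm a + norm b + 1 > 0"
      by (smt (verit) norm_ge_zero)
    have h: "h > 0" using dp pos by (simp add: h_def)
    have near: "dist (x + s *\<^sub>R a + t *\<^sub>R b) x < d" if "0 \<le> s" "s \<le> h" "0 \<le> t" "t \<le> h" for s t
    proof -
      have "norm (s *\<^sub>R a + t *\<^sub>R b) \<le> s * norm a + t * norm b"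
        using norm_triangle_ineq[of "s *\<^sub>R a" "t *\<^sub>R b"] that by simp
      also have "\<dots> \<le> h * norm a + h * norm b"
        using that by (intro add_mono mult_right_mono) auto
      also have "\<dots> \<le> h * (norm a + norm b + 1)"
        using h by (simp add: algebra_simps)
      also have "\<dots> = d / 2"
        using pos by (metis h_def nonzero_eq_divide_eq less_irrefl)
      also have "\<dots> < d" using dp by simp
      finally show ?thesis by (simp add: dist_norm add.assoc)
    qed
    have inS: "x + s *\<^sub>R a + t *\<^sub>R b \<in> S" "x + s *\<^sub>R b + t *\<^sub>R a \<in> S"
      if "0 \<le> s" "s \<le> h" "0 \<le> t" "t \<le> h" for s t
      using near[of s t] near[of t s] that d3(2) d_def
      by (auto simp: dist_commute subset_iff algebra_simps)
    obtain s t where st: "0 < s" "s < h" "0 < t" "t < h"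
      "f (x + h *\<^sub>R a + h *\<^sub>R b) - f (x + h *\<^sub>R a) - f (x + h *\<^sub>R b) + f x
         = h\<^sup>2 * ?L (x + s *\<^sub>R a + t *\<^sub>R b)"
      using second_difference_mean_value[OF assms(2) h inS(1)] by auto
    obtain s' t' where st': "0 < s'" "s' < h" "0 < t'" "t' < h"
      "f (x + h *\<^sub>R b + h *\<^sub>R a) - f (x + h *\<^sub>R b) - f (x + h *\<^sub>R a) + f x
         = h\<^sup>2 * ?R (x + s' *\<^sub>R b + t' *\<^sub>R a)"
      using second_difference_mean_value[OF assms(2) h inS(2)] by auto
    have "h\<^sup>2 * ?L (x + s *\<^sub>R a + t *\<^sub>R b) = h\<^sup>2 * ?R (x + s' *\<^sub>R b + t' *\<^sub>R a)"
      using st(5) st'(5) by (simp add: algebra_simps)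
    then have eq: "?L (x + s *\<^sub>R a + t *\<^sub>R b) = ?R (x + t' *\<^sub>R a + s' *\<^sub>R b)"
      using h by (simp add: algebra_simps)
    have "dist (?L (x + s *\<^sub>R a + t *\<^sub>R b)) (?L x) < e"
      using near[of s t] st d_def by (intro d1) auto
    moreover have "dist (?R (x + t' *\<^sub>R a + s' *\<^sub>R b)) (?R x) < e"
      using near[of t' s'] st' d_def by (intro d2) auto
    ultimately show ?thesis
      unfolding eq by (smt (verit) dist_commute dist_triangle)
  qed
  then have "dist (?L x) (?R x) \<le> 0"
    by (metis field_le_epsilon add_0 mult.commute field_sum_of_halves mult_2 half_gt_zero)
  then show ?thesis by simp
qed

section \<open>Orthonormal eigenframes of symmetric matrices\<close>

text \<open>The maximizer of the Rayleigh quotient on the unit sphere of the subspace is an eigenvector.\<close>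

lemma eigenvector_in_invariant_subspace:
  fixes T :: "'a::euclidean_space \<Rightarrow> 'a"
  assumes T: "linear T" "\<And>x y. T x \<bullet> y = x \<bullet> T y"
    and S: "subspace S" "T ` S \<subseteq> S" "S \<noteq> {0}"
  obtains x c where "x \<in> S" "norm x = 1" "T x = c *\<^sub>R x"
proof -
  let ?K = "S \<inter> sphere 0 1"
  obtain y where y: "y \<in> S" "y \<noteq> 0"
    using S subspace_0 by blast
  then have "(1 / norm y) *\<^sub>R y \<in> ?K"
    using S(1) by (auto simp: subspace_scale)
  then have "?K \<noteq> {}" by blast
  moreover have "compact ?K"
    using closed_subspace[OF S(1)] compact_sphere by (metis compact_Int_closed inf_commute)
  moreover have "continuous_on ?K (\<lambda>x. x \<bullet> T x)"
    using T(1) by (intro continuous_intros linear_continuous_on)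
      (simp add: linear_conv_bounded_linear)
  ultimately obtain x where x: "x \<in> ?K" and max: "\<And>z. z \<in> ?K \<Longrightarrow> z \<bullet> T z \<le> x \<bullet> T x"
    using continuous_attains_sup by metis
  define c where "c = x \<bullet> T x"
  define w where "w = T x - c *\<^sub>R x"
  have xS: "x \<in> S" "norm x = 1" "x \<bullet> x = 1"
    using x by (auto simp: norm_eq_1)
  have wS: "w \<in> S"
    using S xS by (auto simp: w_def subspace_diff subspace_scale image_subset_iff)
  have quad: "z \<bullet> T z \<le> c * (z \<bullet> z)" if "z \<in> S" for z
  proof (cases "z = 0")
    case False
    have "(1 / norm z) *\<^sub>R z \<in> ?K"
      using that S(1) False by (auto simp: subspace_scale)
    from max[OF this] have "(z \<bullet> T z) / (norm z)\<^sup>2 \<le> c"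
      using linear_cmul[OF T(1)] by (simp add: c_def power2_eq_square field_simps)
    then show ?thesis
      using False by (simp add: field_simps power2_norm_eq_inner)
  qed (simp add: linear_0[OF T(1)])
  \<comment> \<open>the quadratic \<open>t \<mapsto> c |x + t w|^2 - (x + t w) \<bullet> T (x + t w)\<close> is nonnegative and vanishes
    at \<open>t = 0\<close>, so its linear coefficient \<open>- 2 (w \<bullet> w)\<close> is zero\<close>
  have lin: "2 * t * (w \<bullet> w) \<le> t\<^sup>2 * (c * (w \<bullet> w) - w \<bullet> T w)" for t
  proof -
    have "(x + t *\<^sub>R w) \<bullet> T (x + t *\<^sub>R w) \<le> c * ((x + t *\<^sub>R w) \<bullet> (x + t *\<^sub>R w))"
      using xS wS S(1) by (intro quad) (auto simp: subspace_add subspace_scale)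
    moreover have "x \<bullet> T w = w \<bullet> w" "T x = w + c *\<^sub>R x" "x \<bullet> w = 0" "w \<bullet> x = 0"
      using T(2)[of x w] xS(3)
      by (simp_all add: w_def c_def inner_commute inner_diff_right inner_diff_left)
    ultimately show ?thesis
      using xS(3)
      by (simp add: linear_add[OF T(1)] linear_cmul[OF T(1)] inner_add_left inner_add_right
          algebra_simps power2_eq_square)
  qed
  have "w \<bullet> w \<le> 0"
  proof (rule ccontr)
    assume w: "\<not> w \<bullet> w \<le> 0"
    \<comment> \<open>the choice \<open>t = (w \<bullet> w) / b\<close> lets the linear term win\<close>
    define b where "b = \<bar>c * (w \<bullet> w) - w \<bullet> T w\<bar> + 1"
    have "b > 0" by (simp add: b_def)
    have "2 * (w \<bullet> w / b) * (w \<bullet> w) \<le> (w \<bullet> w / b)\<^sup>2 * (c * (w \<bullet> w) - w \<bullet> T w)"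
      by (rule lin)
    also have "\<dots> \<le> (w \<bullet> w / b)\<^sup>2 * b"
      by (intro mult_left_mono) (auto simp: b_def)
    also have "\<dots> = (w \<bullet> w / b) * (w \<bullet> w)"
      using \<open>b > 0\<close> by (simp add: power2_eq_square)
    finally show False
      using w \<open>b > 0\<close> by (simp add: field_simps mult_le_0_iff)
  qed
  then have "w = 0"
    using inner_ge_zero[of w] inner_eq_zero_iff[of w] by linarith
  then have "T x = c *\<^sub>R x"
    by (simp add: w_def)
  then show ?thesis
    using that xS by blast
qed

text \<open>Split off one eigenvector \<open>x\<close>; the part of \<open>S\<close> orthogonal to \<open>x\<close> is again invariant, since \<open>T\<close>
  is self-adjoint, and has one dimension less.\<close>

lemma orthonormal_eigenvectors_of_invariant_subspace:
  fixes T :: "'a::euclidean_space \<Rightarrow> 'a"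
  assumes T: "linear T" "\<And>x y. T x \<bullet> y = x \<bullet> T y"
  shows "subspace S \<Longrightarrow> T ` S \<subseteq> S \<Longrightarrow> dim S = n \<Longrightarrow>
    \<exists>B. finite B \<and> card B = n \<and> B \<subseteq> S \<and> pairwise orthogonal B \<and>
      (\<forall>b\<in>B. norm b = 1 \<and> (\<exists>c. T b = c *\<^sub>R b))"
proof (induction n arbitrary: S)
  case 0
  then show ?case by (intro exI[of _ "{}"]) auto
next
  case (Suc n)
  then have "S \<noteq> {0}" by auto
  then obtain x c where x: "x \<in> S" "norm x = 1" "T x = c *\<^sub>R x"
    using eigenvector_in_invariant_subspace[OF T Suc.prems(1,2)] by blast
  have x0: "x \<noteq> 0" using x by auto
  define S' where "S' = {y \<in> S. orthogonal x y}"
  have sub: "subspace S'"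
    using Suc.prems(1) unfolding S'_def subspace_def orthogonal_def by (auto simp: algebra_simps)
  have inv: "T ` S' \<subseteq> S'"
    using Suc.prems(2) x(3) T(2)[of x, symmetric] by (auto simp: S'_def orthogonal_def)
  have "dim S' = n"
  proof -
    have "{y \<in> span S. \<forall>z\<in>span {x}. orthogonal z y} = S'"
      using Suc.prems(1) by (auto simp: S'_def span_eq_iff[THEN iffD2] span_singleton orthogonal_def)
    moreover have "dim {y \<in> span S. \<forall>z\<in>span {x}. orthogonal z y} + dim (span {x}) = dim (span S)"
      using x(1) Suc.prems(1)
      by (intro dim_subspace_orthogonal_to_vectors) (auto simp: span_eq_iff[THEN iffD2] span_minimal)
    moreover have "dim (span {x}) = 1"
      using x0 by (simp add: dim_singleton)
    ultimately show ?thesis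
      using Suc.prems(3) by (simp add: dim_span)
  qed
  from Suc.IH[OF sub inv this] obtain B where B: "finite B" "card B = n" "B \<subseteq> S'"
    "pairwise orthogonal B" "\<forall>b\<in>B. norm b = 1 \<and> (\<exists>c. T b = c *\<^sub>R b)"
    by blast
  have "x \<notin> B"
    using B(3) x0 by (auto simp: S'_def orthogonal_def)
  moreover have "pairwise orthogonal (insert x B)"
    using B(3,4) by (auto simp: pairwise_insert S'_def orthogonal_commute)
  ultimately show ?case
    using B x by (intro exI[of _ "insert x B"]) (auto simp: S'_def)
qed

definition orthonormal_frame :: "('n::finite \<Rightarrow> real^'n) \<Rightarrow> bool" where
  "orthonormal_frame e \<longleftrightarrow> (\<forall>a b. e a \<bullet> e b = (if a = b then 1 else 0))"

lemma symmetric_matrix_eigenframe: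
  fixes M :: "real^'n::finite^'n"
  assumes "transpose M = M"
  obtains e l where "orthonormal_frame e" "\<And>a. M *v e a = l a *\<^sub>R e a"
proof -
  have sa: "(M *v x) \<bullet> y = x \<bullet> (M *v y)" for x y
    using assms by (metis dot_lmul_matrix vector_transpose_matrix)
  obtain B :: "(real^'n) set" where B: "finite B" "card B = CARD('n)" "pairwise orthogonal B"
    "\<forall>b\<in>B. norm b = 1 \<and> (\<exists>c. M *v b = c *\<^sub>R b)"
    using orthonormal_eigenvectors_of_invariant_subspace
      [OF matrix_vector_mul_linear sa subspace_UNIV]
    by auto
  obtain e where e: "bij_betw e (UNIV::'n set) B"
    using B finite_same_card_bij by (metis finite_class.finite_UNIV)
  have "e a \<bullet> e b = (if a = b then 1 else 0)" for a b
  proof (cases "a = b")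
    case True
    then show ?thesis using e B(4) by (auto simp: bij_betw_def norm_eq_1)
  next
    case False
    then have "e a \<noteq> e b" "e a \<in> B" "e b \<in> B"
      using e by (auto simp: bij_betw_def inj_on_def)
    then show ?thesis
      using B(3) False by (auto simp: pairwise_def orthogonal_def)
  qed
  moreover have "\<exists>l. \<forall>a. M *v e a = l a *\<^sub>R e a"
  proof -
    have "\<forall>a. \<exists>c. M *v e a = c *\<^sub>R e a"
      using e B(4) by (auto simp: bij_betw_def)
    then show ?thesis by metis
  qed
  ultimately show ?thesis
    using that unfolding orthonormal_frame_def by blast
qed

text \<open>Orthonormality of the rows is the first identity; the second follows because a right inverse
  of a square matrix is a left inverse, and read entrywise it is the completeness of the frame.\<close>

lemma orthonormal_frame_matrix:
  fixes e :: "'n::finite \<Rightarrow> real^'n"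
  assumes "orthonormal_frame e"
  defines "P \<equiv> \<chi> a. e a"
  shows "P ** transpose P = mat 1" "transpose P ** P = mat 1"
proof -
  show "P ** transpose P = mat 1"
    using assms(1) unfolding orthonormal_frame_def P_def
    by (simp add: vec_eq_iff matrix_matrix_mult_def transpose_def mat_def inner_vec_def)
  then show "transpose P ** P = mat 1"
    using matrix_left_right_inverse by blast
qed

lemma orthonormal_frame_complete:
  fixes e :: "'n::finite \<Rightarrow> real^'n"
  assumes "orthonormal_frame e"
  shows "(\<Sum>a\<in>UNIV. e a $ i * e a $ j) = (if i = j then 1 else 0)"
  using orthonormal_frame_matrix(2)[OF assms]
  by (simp add: vec_eq_iff matrix_matrix_mult_def transpose_def mat_def)

lemma parseval:
  fixes e :: "'n::finite \<Rightarrow> real^'n"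
  assumes "orthonormal_frame e"
  shows "(\<Sum>a\<in>UNIV. (e a \<bullet> v) * (e a \<bullet> w)) = v \<bullet> w"
proof -
  have "(\<Sum>a\<in>UNIV. (e a \<bullet> v) * (e a \<bullet> w))
      = (\<Sum>a\<in>UNIV. \<Sum>i\<in>UNIV. \<Sum>j\<in>UNIV. (e a $ i * e a $ j) * (v $ i * w $ j))"
    by (simp add: inner_vec_def sum_product algebra_simps)
  also have "\<dots> = (\<Sum>i\<in>UNIV. \<Sum>a\<in>UNIV. \<Sum>j\<in>UNIV. (e a $ i * e a $ j) * (v $ i * w $ j))"
    by (rule sum.swap)
  also have "\<dots> = (\<Sum>i\<in>UNIV. \<Sum>j\<in>UNIV. \<Sum>a\<in>UNIV. (e a $ i * e a $ j) * (v $ i * w $ j))"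
    by (intro sum.cong refl sum.swap)
  also have "\<dots> = (\<Sum>i\<in>UNIV. \<Sum>j\<in>UNIV. (if i = j then 1 else 0) * (v $ i * w $ j))"
    by (simp add: sum_distrib_right[symmetric] orthonormal_frame_complete[OF assms])
  also have "\<dots> = v \<bullet> w"
    by (simp add: inner_vec_def if_distrib[of "\<lambda>c. c * _"] cong: if_cong)
  finally show ?thesis .
qed

lemma frame_expansion:
  fixes e :: "'n::finite \<Rightarrow> real^'n"
  assumes "orthonormal_frame e"
  shows "v = (\<Sum>a\<in>UNIV. (e a \<bullet> v) *\<^sub>R e a)"
proof (rule vector_eq_ldot[THEN iffD1], rule allI)
  fix w
  show "w \<bullet> v = w \<bullet> (\<Sum>a\<in>UNIV. (e a \<bullet> v) *\<^sub>R e a)"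
    using parseval[OF assms, of v w] by (simp add: inner_sum_right inner_commute)
qed

lemma trace_frame:
  fixes M :: "real^'n::finite^'n"
  assumes "orthonormal_frame e"
  shows "(\<Sum>a\<in>UNIV. e a \<bullet> (M *v e a)) = trace M"
proof -
  have "(\<Sum>a\<in>UNIV. e a \<bullet> (M *v e a))
      = (\<Sum>a\<in>UNIV. \<Sum>i\<in>UNIV. \<Sum>j\<in>UNIV. (e a $ i * e a $ j) * M $ i $ j)"
    by (simp add: inner_vec_def matrix_vector_mult_def sum_distrib_left algebra_simps)
  also have "\<dots> = (\<Sum>i\<in>UNIV. \<Sum>a\<in>UNIV. \<Sum>j\<in>UNIV. (e a $ i * e a $ j) * M $ i $ j)"
    by (rule sum.swap)
  also have "\<dots> = (\<Sum>i\<in>UNIV. \<Sum>j\<in>UNIV. \<Sum>a\<in>UNIV. (e a $ i * e a $ j) * M $ i $ j)"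
    by (intro sum.cong refl sum.swap)
  also have "\<dots> = (\<Sum>i\<in>UNIV. \<Sum>j\<in>UNIV. (if i = j then 1 else 0) * M $ i $ j)"
    by (simp add: sum_distrib_right[symmetric] orthonormal_frame_complete[OF assms])
  also have "\<dots> = trace M"
    by (simp add: trace_def if_distrib[of "\<lambda>c. c * _"] cong: if_cong)
  finally show ?thesis .
qed

lemma sum_squares_frame:
  fixes M :: "real^'n::finite^'n"
  assumes "orthonormal_frame e"
  shows "(\<Sum>a\<in>UNIV. \<Sum>b\<in>UNIV. (e a \<bullet> (M *v e b))\<^sup>2) = (\<Sum>i\<in>UNIV. \<Sum>j\<in>UNIV. (M $ i $ j)\<^sup>2)"
proof -
  have "(\<Sum>a\<in>UNIV. \<Sum>b\<in>UNIV. (e a \<bullet> (M *v e b))\<^sup>2)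
      = (\<Sum>b\<in>UNIV. \<Sum>a\<in>UNIV. (e a \<bullet> (M *v e b))\<^sup>2)"
    by (rule sum.swap)
  also have "\<dots> = (\<Sum>b\<in>UNIV. (M *v e b) \<bullet> (M *v e b))"
    by (simp add: power2_eq_square parseval[OF assms])
  also have "\<dots> = (\<Sum>b\<in>UNIV. \<Sum>i\<in>UNIV. (e b \<bullet> M $ i) * (e b \<bullet> M $ i))"
    by (simp add: inner_vec_def[of "M *v _"] matrix_vector_mul_component inner_commute)
  also have "\<dots> = (\<Sum>i\<in>UNIV. \<Sum>b\<in>UNIV. (e b \<bullet> M $ i) * (e b \<bullet> M $ i))"
    by (rule sum.swap)
  also have "\<dots> = (\<Sum>i\<in>UNIV. M $ i \<bullet> M $ i)"
    by (simp add: parseval[OF assms])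
  finally show ?thesis
    by (simp add: inner_vec_def power2_eq_square)
qed

text \<open>Conjugation with the orthogonal matrix of the frame diagonalizes \<open>M\<close>; lifted to matrices of
  constant polynomials, it commutes with the scalar matrix \<open>X\<close> and leaves the determinant
  unchanged.\<close>

lemma charpoly_eigenframe:
  fixes M :: "real^'n::finite^'n"
  assumes e: "orthonormal_frame e" and l: "\<And>a. M *v e a = l a *\<^sub>R e a"
  shows "charpoly M = (\<Prod>a\<in>UNIV. [:- l a, 1:])"
proof -
  define P where "P = (\<chi> a. e a)"
  define C where "C = (\<lambda>A::real^'n^'n. (\<chi> i j. [:A $ i $ j:]))"
  have Cmul: "C (A ** B) = C A ** C B" for A B
  proof -
    have "[:\<Sum>k\<in>UNIV. A $ i $ k * B $ k $ j:] = (\<Sum>k\<in>UNIV. [:A $ i $ k:] * [:B $ k $ j:])" for i j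
      by (rule poly_eqI) (simp add: coeff_sum coeff_pCons mult.commute split: nat.split)
    then show ?thesis
      by (simp add: C_def matrix_matrix_mult_def vec_eq_iff)
  qed
  have C1: "C (mat 1) = mat 1"
    by (simp add: C_def mat_def vec_eq_iff)
  have PM: "P ** M ** transpose P = (\<chi> a b. if a = b then l a else 0)"
  proof -
    have "(P ** (M ** transpose P)) $ a $ b = e a \<bullet> (M *v e b)" for a b
      by (simp add: P_def matrix_matrix_mult_def matrix_vector_mult_def transpose_def inner_vec_def)
    then show ?thesis
      using e by (simp add: vec_eq_iff l orthonormal_frame_def matrix_mul_assoc)
  qed
  let ?X = "mat [:0, 1:] :: real poly^'n^'n"
  have X: "Q ** ?X ** R = ?X ** (Q ** R)" for Q R :: "real poly^'n^'n"
  proof -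
    have "Q ** ?X = ?X ** Q"
      by (simp add: matrix_matrix_mult_def mat_def vec_eq_iff if_distrib[of "\<lambda>c. c * _"]
          if_distrib[of "\<lambda>c. _ * c"] cong: if_cong)
    then show ?thesis by (simp add: matrix_mul_assoc)
  qed
  have dd: "det (C P) * det (C (transpose P)) = 1"
    using orthonormal_frame_matrix(1)[OF e] by (simp add: P_def det_mul[symmetric] Cmul[symmetric] C1)
  have "charpoly M = det (?X - C M)"
    by (simp add: charpoly_def C_def)
  also have "\<dots> = det (C P) * det (?X - C M) * det (C (transpose P))"
    using dd by (simp add: ac_simps)
  also have "\<dots> = det (C P ** (?X - C M) ** C (transpose P))"
    by (simp add: det_mul)
  also have "C P ** (?X - C M) ** C (transpose P) = ?X - C (P ** M ** transpose P)"
  proof -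
    have "C P ** (?X - C M) ** C (transpose P)
        = C P ** ?X ** C (transpose P) - C P ** C M ** C (transpose P)"
      by (simp add: matrix_matrix_mult_def vec_eq_iff algebra_simps sum_subtractf sum_distrib_left)
    also have "C P ** ?X ** C (transpose P) = ?X"
      using orthonormal_frame_matrix(1)[OF e] by (simp add: X P_def Cmul[symmetric] C1)
    finally show ?thesis by (simp add: Cmul)
  qed
  also have "det \<dots> = (\<Prod>a\<in>UNIV. [:- l a, 1:])"
    by (subst det_diagonal) (auto simp: PM C_def mat_def)
  finally show ?thesis .
qed

lemma two_sum_pairs_list:
  fixes l :: "real list"
  shows "2 * (\<Sum>j<length l. \<Sum>i<j. l ! i * l ! j) = (sum_list l)\<^sup>2 - sum_list (map (\<lambda>x. x\<^sup>2) l)"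
proof (induction l rule: rev_induct)
  case (snoc x l)
  have "(\<Sum>i<length l. l ! i * x) = sum_list l * x"
    by (simp add: sum_list_sum_nth sum_distrib_right atLeast0LessThan)
  moreover have "(\<Sum>j<length l. \<Sum>i<j. (l @ [x]) ! i * (l @ [x]) ! j)
      = (\<Sum>j<length l. \<Sum>i<j. l ! i * l ! j)"
    by (intro sum.cong) (auto simp: nth_append)
  ultimately show ?case
    using snoc by (simp add: nth_append power2_eq_square algebra_simps)
qed simp

lemma two_sigma2_eigenframe:
  fixes M :: "real^'n::finite^'n"
  assumes "orthonormal_frame e" "\<And>a. M *v e a = l a *\<^sub>R e a"
  shows "2 * sigma2 M = (\<Sum>a\<in>UNIV. l a)\<^sup>2 - (\<Sum>a\<in>UNIV. (l a)\<^sup>2)"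
proof -
  have "proots (charpoly M) = (\<Sum>a\<in>UNIV. {#l a#})"
    by (simp add: charpoly_eigenframe[OF assms] proots_prod)
  then have "mset (eigenvalues M) = (\<Sum>a\<in>UNIV. {#l a#})"
    by (simp add: eigenvalues_def)
  then have m: "mset (eigenvalues M) = image_mset l (mset_set UNIV)"
    by (metis sum_unfold_sum_mset sum_mset_singleton_mset image_mset.compositionality)
  have "sum_list (map f (eigenvalues M)) = (\<Sum>a\<in>UNIV. f (l a))" for f :: "real \<Rightarrow> real"
  proof -
    have "sum_list (map f (eigenvalues M)) = sum_mset (image_mset f (mset (eigenvalues M)))"
      by (simp flip: sum_mset_sum_list)
    then show ?thesis
      by (simp add: m sum_unfold_sum_mset image_mset.compositionality comp_def)
  qed
  from this[of "\<lambda>x. x"] this[of "\<lambda>x. x\<^sup>2"] show ?thesis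
    using two_sum_pairs_list[of "eigenvalues M"] by (simp add: sigma2_def Let_def)
qed

lemma frame_quadratic_eigen:
  fixes M :: "real^'n::finite^'n"
  assumes "orthonormal_frame e" "\<And>a. M *v e a = l a *\<^sub>R e a"
  shows "trace M = (\<Sum>a\<in>UNIV. l a)"
    and "(\<Sum>i\<in>UNIV. \<Sum>j\<in>UNIV. (M $ i $ j)\<^sup>2) = (\<Sum>a\<in>UNIV. (l a)\<^sup>2)"
    and "positive_semidefinite M \<Longrightarrow> 0 \<le> l a"
proof -
  have i: "e a \<bullet> (M *v e b) = (if a = b then l a else 0)" for a b
    using assms by (simp add: orthonormal_frame_def)
  show "trace M = (\<Sum>a\<in>UNIV. l a)"
    using trace_frame[OF assms(1), of M] by (simp add: i)
  show "(\<Sum>i\<in>UNIV. \<Sum>j\<in>UNIV. (M $ i $ j)\<^sup>2) = (\<Sum>a\<in>UNIV. (l a)\<^sup>2)"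
    using sum_squares_frame[OF assms(1), of M]
    by (simp add: i if_distrib[of "\<lambda>c. c\<^sup>2"] cong: if_cong)
  show "0 \<le> l a" if "positive_semidefinite M"
    using that i[of a a] by (metis positive_semidefinite_def)
qed

text \<open>The hypothesis says \<open>\<Sum>\<^sub>a l\<^sub>a (s - l\<^sub>a) = 0\<close> where \<open>s\<close> is the sum of all \<open>l\<^sub>a\<close>. All terms are
  nonnegative, so a positive eigenvalue equals \<open>s\<close> and leaves nothing for the others.\<close>

lemma rank_one_eigenframe:
  fixes M :: "real^'n::finite^'n"
  assumes e: "orthonormal_frame e" and l: "\<And>a. M *v e a = l a *\<^sub>R e a"
    and nn: "\<And>a. 0 \<le> l a" and pos: "0 < (\<Sum>a\<in>UNIV. l a)"
    and eq: "(\<Sum>a\<in>UNIV. l a)\<^sup>2 = (\<Sum>a\<in>UNIV. (l a)\<^sup>2)"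
  shows "rank M = 1"
proof -
  obtain k where k: "l k > 0"
    using pos nn by (metis less_eq_real_def not_less sum_nonpos)
  have z: "l a = 0" if "a \<noteq> k" for a
  proof -
    have "0 = (\<Sum>a\<in>UNIV. l a * (sum l UNIV - l a))"
      using eq by (simp add: power2_eq_square right_diff_distrib sum_subtractf sum_distrib_right)
    moreover have "l a * (sum l UNIV - l a) \<ge> 0" for a
      using nn member_le_sum[of a UNIV l] by (intro mult_nonneg_nonneg) auto
    ultimately have "l k * (sum l UNIV - l k) = 0"
      using sum_nonneg_eq_0_iff[of UNIV "\<lambda>a. l a * (sum l UNIV - l a)"] by simp
    then have "sum l UNIV = l k" using k by simp
    then have "sum l (UNIV - {k}) = 0"
      by (simp add: sum_diff1)
    then show ?thesis
      using that nn by (simp add: sum_nonneg_eq_0_iff)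
  qed
  have M: "M *v v = (l k * (e k \<bullet> v)) *\<^sub>R e k" for v
  proof -
    have "M *v v = M *v (\<Sum>a\<in>UNIV. (e a \<bullet> v) *\<^sub>R e a)"
      using frame_expansion[OF e] by metis
    also have "\<dots> = (\<Sum>a\<in>UNIV. (e a \<bullet> v) *\<^sub>R (l a *\<^sub>R e a))"
      by (simp add: linear_sum[OF matrix_vector_mul_linear] matrix_vector_mult_scaleR l)
    also have "\<dots> = (\<Sum>a\<in>UNIV. if a = k then (l k * (e k \<bullet> v)) *\<^sub>R e k else 0)"
      using z by (intro sum.cong) auto
    finally show ?thesis by simp
  qed
  have ek: "e k \<bullet> e k = 1"
    using e by (simp add: orthonormal_frame_def)
  then have ek0: "e k \<noteq> 0" by auto
  have "range (\<lambda>v. M *v v) = span {e k}"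
  proof
    show "range (\<lambda>v. M *v v) \<subseteq> span {e k}"
      by (auto simp: M span_singleton)
    show "span {e k} \<subseteq> range (\<lambda>v. M *v v)"
    proof
      fix y assume "y \<in> span {e k}"
      then obtain c where "y = c *\<^sub>R e k" by (auto simp: span_singleton)
      then have "y = M *v ((c / l k) *\<^sub>R e k)"
        using ek k by (simp add: M)
      then show "y \<in> range (\<lambda>v. M *v v)" by blast
    qed
  qed
  then show ?thesis
    using ek0 by (simp add: rank_dim_range dim_singleton)
qed

section \<open>Hopf's strong minimum principle\<close>

text \<open>If \<open>c\<close> were negative, \<open>f'\<close> would be negative just to the right of \<open>0\<close>, and \<open>f\<close> would decrease
  there.\<close>

lemma second_derivative_nonneg_at_local_min:
  fixes f f' :: "real \<Rightarrow> real"
  assumes d: "0 < d" "\<And>t. \<bar>t\<bar> < d \<Longrightarrow> (f has_real_derivative f' t) (at t)"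
    and c: "(f' has_real_derivative c) (at 0)"
    and min: "\<And>t. \<bar>t\<bar> < d \<Longrightarrow> f 0 \<le> f t"
  shows "f' 0 = 0" "0 \<le> c"
proof -
  show z: "f' 0 = 0"
    using DERIV_local_min[OF d(2)[of 0] d(1)] d(1) min by auto
  show "0 \<le> c"
  proof (rule ccontr)
    assume "\<not> 0 \<le> c"
    then obtain r where r: "r > 0" "\<And>h. 0 < h \<Longrightarrow> h < r \<Longrightarrow> f' h < 0"
      using DERIV_neg_dec_right[OF c] z by auto
    define t where "t = min r d / 2"
    have t: "0 < t" "t < r" "t < d"
      using r(1) d(1) by (auto simp: t_def)
    obtain s where s: "0 < s" "s < t" "f t - f 0 = (t - 0) * f' s"
      using MVT2[OF t(1), of f f'] d(2) t by auto
    have "f t - f 0 < 0"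
      using s r(2)[of s] t by (simp add: mult_pos_neg)
    then show False using min[of t] t by auto
  qed
qed

text \<open>The second derivative test at a local minimum of \<open>f - w\<close>. The comparison function \<open>w\<close> enters
  only through its restrictions to coordinate lines through \<open>z\<close>, so that for an explicit \<open>w\<close>
  only one-variable derivatives have to be computed.\<close>

lemma local_min_gradient_laplacian:
  fixes f w :: "real^'n::finite \<Rightarrow> real" and W :: "'n \<Rightarrow> real \<Rightarrow> real" and w2 :: "'n \<Rightarrow> real"
  assumes S: "open S" "smooth_on S f" "z \<in> S"
    and w: "\<And>k t. ((\<lambda>s. w (z + s *\<^sub>R axis k 1)) has_real_derivative W k t) (at t)"
           "\<And>k. (W k has_real_derivative w2 k) (at 0)"
    and min: "r > 0" "\<And>y. y \<in> ball z r \<Longrightarrow> f z - w z \<le> f y - w y"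
  shows "dir_deriv (axis k 1) f z = W k 0"
    and "w2 k \<le> dir_deriv (axis k 1) (dir_deriv (axis k 1) f) z"
proof -
  obtain r' where r': "r' > 0" "ball z r' \<subseteq> S"
    using S openE by blast
  define d where "d = min r r'"
  let ?e = "axis k (1::real) :: real^'n"
  have in_S: "z + t *\<^sub>R ?e \<in> S" "z + t *\<^sub>R ?e \<in> ball z r" if "\<bar>t\<bar> < d" for t
    using that r' by (auto simp: d_def dist_norm norm_axis_1 subset_iff)
  have 1: "((\<lambda>s. f (z + s *\<^sub>R ?e) - w (z + s *\<^sub>R ?e)) has_real_derivative
      dir_deriv ?e f (z + t *\<^sub>R ?e) - W k t) (at t)" if "\<bar>t\<bar> < d" for t
    using in_S[OF that] smooth_on_differentiable[OF S(2)]
    by (intro DERIV_diff w(1) DERIV_along_line) auto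
  have 2: "((\<lambda>t. dir_deriv ?e f (z + t *\<^sub>R ?e) - W k t) has_real_derivative
      dir_deriv ?e (dir_deriv ?e f) (z + 0 *\<^sub>R ?e) - w2 k) (at 0)"
    using S(3) smooth_on_differentiable[OF smooth_on_dir_deriv[OF S(2)]]
    by (intro DERIV_diff w(2) DERIV_along_line) auto
  have dpos: "0 < d" using r'(1) min(1) by (simp add: d_def)
  note nn = second_derivative_nonneg_at_local_min[OF dpos 1 2]
  have m: "f (z + 0 *\<^sub>R ?e) - w (z + 0 *\<^sub>R ?e) \<le> f (z + t *\<^sub>R ?e) - w (z + t *\<^sub>R ?e)"
    if "\<bar>t\<bar> < d" for t
    using min(2)[OF in_S(2)[OF that]] by simp
  show "dir_deriv ?e f z = W k 0" "w2 k \<le> dir_deriv ?e (dir_deriv ?e f) z"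
    using nn[OF _ m] by auto
qed

text \<open>Hopf's barrier argument. Near its boundary point \<open>p\<close>, the function \<open>f\<close> exceeds \<open>f p\<close> on a ball
  with centre \<open>q\<close>. The function \<open>w\<close>, a Gaussian in the distance from \<open>q\<close> shifted so as to vanish
  on the boundary of that ball, satisfies \<open>\<Delta>w > C |\<nabla>w|\<close> near \<open>p\<close> when the Gaussian is steep. For
  small \<open>\<epsilon>\<close> the function \<open>f - \<epsilon> w\<close> is larger than \<open>f p\<close> on the boundary of a small ball around
  \<open>p\<close>: where \<open>w < 0\<close> because of the sign of \<open>w\<close>, elsewhere by compactness. Since it equals \<open>f p\<close>
  at \<open>p\<close>, it has an interior minimum, at which the gradients of \<open>f\<close> and \<open>\<epsilon> w\<close> agree and
  \<open>\<Delta>f \<ge> \<epsilon> \<Delta>w\<close>. This contradicts the differential inequality for \<open>f\<close>.\<close>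

lemma strong_minimum_principle_at_touching_ball:
  fixes f :: "real^'n::finite \<Rightarrow> real"
  assumes S: "open S" "smooth_on S f"
    and ineq: "\<And>x. x \<in> S \<Longrightarrow> (\<Sum>k\<in>UNIV. dir_deriv (axis k 1) (dir_deriv (axis k 1) f) x)
                 \<le> C * norm (\<chi> k. dir_deriv (axis k 1) f x)"
    and C: "0 \<le> C"
    and \<rho>: "0 < \<rho>" "dist p q = \<rho>" "cball p (\<rho> / 2) \<subseteq> S"
    and ge: "\<And>x. x \<in> cball p (\<rho> / 2) \<Longrightarrow> f p \<le> f x"
    and gt: "\<And>x. x \<in> cball p (\<rho> / 2) \<Longrightarrow> x \<in> cball q \<rho> \<Longrightarrow> x \<noteq> p \<Longrightarrow> f p < f x"
  shows False
proof -
  \<comment> \<open>steep enough for \<open>\<Delta>w > C |\<nabla>w|\<close> at distances from \<open>q\<close> between \<open>\<rho> / 2\<close> and \<open>2 \<rho>\<close>\<close>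
  define \<alpha> where "\<alpha> = (CARD('n) + C * (2 * \<rho>)) / (2 * (\<rho> / 2)\<^sup>2) + 1"
  have \<alpha>: "0 < \<alpha>" "CARD('n) + C * (2 * \<rho>) < 2 * \<alpha> * (\<rho> / 2)\<^sup>2"
  proof -
    have "0 \<le> (CARD('n) + C * (2 * \<rho>)) / (2 * (\<rho> / 2)\<^sup>2)"
      using C \<rho>(1) by (intro divide_nonneg_nonneg) auto
    then show "0 < \<alpha>" by (simp add: \<alpha>_def)
    have "2 * \<alpha> * (\<rho> / 2)\<^sup>2 = CARD('n) + C * (2 * \<rho>) + 2 * (\<rho> / 2)\<^sup>2"
      using \<rho>(1) by (simp add: \<alpha>_def field_simps)
    then show "CARD('n) + C * (2 * \<rho>) < 2 * \<alpha> * (\<rho> / 2)\<^sup>2"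
      using \<rho>(1) by simp
  qed
  define E where "E = (\<lambda>x. exp (- \<alpha> * ((x - q) \<bullet> (x - q))))"
  define w where "w = (\<lambda>x. E x - exp (- \<alpha> * \<rho>\<^sup>2))"
  have E_le: "E x \<le> 1" for x using \<alpha>(1) by (simp add: E_def)
  have w_le: "w x \<le> 1" for x
    unfolding w_def using E_le[of x] exp_ge_zero[of "- \<alpha> * \<rho>\<^sup>2"] by linarith
  have w_p: "w p = 0"
    using \<rho>(2) by (simp add: w_def E_def dist_norm power2_norm_eq_inner[symmetric])
  have w_neg: "w x < 0" if "x \<notin> cball q \<rho>" for x
  proof -
    have "\<rho> < norm (x - q)" using that by (simp add: dist_norm norm_minus_commute)
    then have "\<rho>\<^sup>2 < (norm (x - q))\<^sup>2" using \<rho>(1) by (intro power_strict_mono) auto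
    then show ?thesis using \<alpha>(1) by (simp add: w_def E_def power2_norm_eq_inner)
  qed
  let ?K = "cball p (\<rho> / 2)" and ?A = "sphere p (\<rho> / 2) \<inter> cball q \<rho>"
  have fc: "continuous_on ?K f"
    using continuous_on_subset[OF smooth_on_continuous[OF S(2)] \<rho>(3)] .
  obtain \<epsilon> where \<epsilon>: "0 < \<epsilon>" "\<And>x. x \<in> ?A \<Longrightarrow> f p + \<epsilon> < f x"
  proof (cases "?A = {}")
    case True
    then show ?thesis using that[of 1] by auto
  next
    case False
    have "compact ?A" by (simp add: compact_Int_closed)
    moreover have "continuous_on ?A f"
      using fc by (rule continuous_on_subset) auto
    ultimately obtain y where y: "y \<in> ?A" "\<And>x. x \<in> ?A \<Longrightarrow> f y \<le> f x"
      using continuous_attains_inf False by metis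
    have "f p < f y"
      using y(1) \<rho>(1) by (intro gt) auto
    then show ?thesis
      using that[of "(f y - f p) / 2"] y(2) by (force simp: field_simps)
  qed
  have "continuous_on ?K (\<lambda>x. f x - \<epsilon> * w x)"
    unfolding w_def E_def using fc by (intro continuous_intros)
  then obtain z where z: "z \<in> ?K" "\<And>x. x \<in> ?K \<Longrightarrow> f z - \<epsilon> * w z \<le> f x - \<epsilon> * w x"
    using continuous_attains_inf[of ?K "\<lambda>x. f x - \<epsilon> * w x"] \<rho>(1) by auto
  have "z \<notin> sphere p (\<rho> / 2)"
  proof
    assume zs: "z \<in> sphere p (\<rho> / 2)"
    have "f p < f z - \<epsilon> * w z"
    proof (cases "z \<in> cball q \<rho>")
      case True
      then have "f p + \<epsilon> < f z" using \<epsilon>(2) zs by blast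
      moreover have "\<epsilon> * w z \<le> \<epsilon> * 1" using w_le \<epsilon>(1) by (intro mult_left_mono) auto
      ultimately show ?thesis by simp
    next
      case False
      then have "\<epsilon> * w z < 0" using w_neg \<epsilon>(1) by (simp add: mult_pos_neg)
      then show ?thesis using ge[OF z(1)] by simp
    qed
    moreover have "f z - \<epsilon> * w z \<le> f p"
      using z(2)[of p] w_p \<rho>(1) by simp
    ultimately show False by simp
  qed
  then have zb: "z \<in> ball p (\<rho> / 2)" using z(1) by (auto simp: sphere_def)
  obtain r where r: "r > 0" "ball z r \<subseteq> ball p (\<rho> / 2)"
    using zb openE[OF open_ball] by metis
  have min: "f z - \<epsilon> * w z \<le> f y - \<epsilon> * w y" if "y \<in> ball z r" for y
    using that r(2) by (intro z(2)) (auto simp: subset_iff)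
  have zS: "z \<in> S" using z(1) \<rho>(3) by blast
  define v where "v = z - q"
  have sq: "(z + s *\<^sub>R axis k 1 - q) \<bullet> (z + s *\<^sub>R axis k 1 - q) = v \<bullet> v + 2 * s * v $ k + s\<^sup>2"
    for s :: real and k
    by (simp add: v_def algebra_simps inner_axis inner_axis_axis inner_commute[of "axis k 1"]
        power2_eq_square)
  define H where "H = (\<lambda>k s. exp (- \<alpha> * (v \<bullet> v + 2 * s * v $ k + s\<^sup>2)))"
  define W where "W = (\<lambda>k s. - \<epsilon> * (2 * \<alpha>) * (v $ k + s) * H k s)"
  define w2 where "w2 = (\<lambda>k. \<epsilon> * E z * (4 * \<alpha>\<^sup>2 * (v $ k)\<^sup>2 - 2 * \<alpha>))"
  have d1: "((\<lambda>s. \<epsilon> * w (z + s *\<^sub>R axis k 1)) has_real_derivative W k t) (at t)" for k t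
    unfolding w_def E_def sq W_def H_def
    by (auto intro!: derivative_eq_intros simp: algebra_simps)
  have Ez: "E z = exp (- \<alpha> * (v \<bullet> v))" by (simp add: E_def v_def)
  have d2: "(W k has_real_derivative w2 k) (at 0)" for k
    unfolding W_def H_def w2_def Ez
    by (auto intro!: derivative_eq_intros simp: algebra_simps power2_eq_square)
  have grad: "dir_deriv (axis k 1) f z = - 2 * \<epsilon> * \<alpha> * E z * v $ k" for k
    using local_min_gradient_laplacian(1)[OF S zS d1 d2 r(1) min]
    by (simp add: W_def H_def Ez algebra_simps)
  have lap: "w2 k \<le> dir_deriv (axis k 1) (dir_deriv (axis k 1) f) z" for k
    using local_min_gradient_laplacian(2)[OF S zS d1 d2 r(1) min] .
  have Epos: "0 < \<epsilon> * E z * (2 * \<alpha>)" using \<epsilon>(1) \<alpha>(1) by (simp add: E_def)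
  have "(\<epsilon> * E z * (2 * \<alpha>)) * (2 * \<alpha> * (norm v)\<^sup>2 - CARD('n)) = (\<Sum>k\<in>UNIV. w2 k)"
  proof -
    have "(\<Sum>k\<in>UNIV. (v $ k)\<^sup>2) = (norm v)\<^sup>2"
      unfolding power2_norm_eq_inner inner_vec_def by (simp add: power2_eq_square)
    then have "(\<Sum>k\<in>UNIV. w2 k) = \<epsilon> * E z * (4 * \<alpha>\<^sup>2 * (norm v)\<^sup>2 - CARD('n) * (2 * \<alpha>))"
      by (simp add: w2_def sum_subtractf flip: sum_distrib_left)
    then show ?thesis by (simp add: power2_eq_square algebra_simps)
  qed
  also have "\<dots> \<le> (\<Sum>k\<in>UNIV. dir_deriv (axis k 1) (dir_deriv (axis k 1) f) z)"
    by (intro sum_mono lap)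
  also have "\<dots> \<le> C * norm (\<chi> k. dir_deriv (axis k 1) f z)"
    by (rule ineq[OF zS])
  also have "(\<chi> k. dir_deriv (axis k 1) f z) = - (\<epsilon> * E z * (2 * \<alpha>)) *\<^sub>R v"
    by (simp add: grad vec_eq_iff)
  also have "C * norm \<dots> = (\<epsilon> * E z * (2 * \<alpha>)) * (C * norm v)"
    using Epos by (simp add: abs_of_pos del: mult_pos_pos)
  finally have key: "2 * \<alpha> * (norm v)\<^sup>2 - CARD('n) \<le> C * norm v"
    using Epos by (simp only: mult_le_cancel_left_pos)
  have nz: "norm (z - p) \<le> \<rho> / 2" "norm (p - q) = \<rho>"
    using z(1) \<rho>(2) by (auto simp: dist_norm norm_minus_commute)
  have "norm v \<le> 2 * \<rho>" "\<rho> / 2 \<le> norm v"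
    using norm_triangle_ineq[of "z - p" "p - q"] norm_triangle_ineq[of "p - z" "z - q"] nz
    by (auto simp: v_def norm_minus_commute)
  then have "C * norm v \<le> C * (2 * \<rho>)" "2 * \<alpha> * (\<rho> / 2)\<^sup>2 \<le> 2 * \<alpha> * (norm v)\<^sup>2"
    using C \<alpha>(1) \<rho>(1) by (auto intro!: mult_left_mono power_mono)
  then show False using key \<alpha>(2) by linarith
qed

text \<open>If \<open>f y\<close> were larger than the minimum, the largest open ball around \<open>y\<close> that misses the
  minimum set would touch it at some point \<open>p\<close>. The ball of half the radius that is internally
  tangent at \<open>p\<close> has no other point of the minimum set in its closure, as the touching-ball
  lemma requires. The factor \<open>1/3\<close> keeps all these balls inside \<open>ball x0 r\<close>.\<close>

lemma strong_minimum_principle: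
  fixes f :: "real^'n::finite \<Rightarrow> real"
  assumes f: "smooth_on (ball x0 r) f" and "0 < r" and C: "0 \<le> C"
    and ineq: "\<And>x. x \<in> ball x0 r \<Longrightarrow> (\<Sum>k\<in>UNIV. dir_deriv (axis k 1) (dir_deriv (axis k 1) f) x)
                 \<le> C * norm (\<chi> k. dir_deriv (axis k 1) f x)"
    and min: "\<And>x. x \<in> ball x0 r \<Longrightarrow> f x0 \<le> f x"
    and y: "y \<in> ball x0 (r / 3)"
  shows "f y = f x0"
proof (rule ccontr)
  assume ne: "f y \<noteq> f x0"
  define R where "R = dist y x0"
  have R: "R < r / 3" using y by (simp add: R_def dist_commute)
  define Z where "Z = {x \<in> cball y R. f x = f x0}"
  have sub: "cball y R \<subseteq> ball x0 r"
  proof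
    fix x assume "x \<in> cball y R"
    then have "dist x0 x \<le> R + R"
      using dist_triangle[of x0 x y] by (simp add: R_def dist_commute)
    then have "dist x0 x < r" using R zero_le_dist[of x0 x] by linarith
    then show "x \<in> ball x0 r" by simp
  qed
  have fc: "continuous_on (cball y R) f"
    using continuous_on_subset[OF smooth_on_continuous[OF f] sub] .
  have "closed Z"
    using continuous_closed_preimage_constant[OF fc closed_cball] unfolding Z_def .
  moreover have "x0 \<in> Z" by (simp add: Z_def R_def)
  ultimately obtain p where p: "p \<in> Z" "\<And>x. x \<in> Z \<Longrightarrow> dist y p \<le> dist y x"
    using distance_attains_inf[of Z y] by blast
  define \<rho> where "\<rho> = dist y p / 2"
  define q where "q = (1/2) *\<^sub>R (y + p)"
  have fp: "f p = f x0" and dyp: "dist y p \<le> R" using p(1) by (auto simp: Z_def)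
  have "y \<noteq> p" using ne fp by auto
  then have \<rho>: "0 < \<rho>" by (simp add: \<rho>_def)
  have "p - q = (1/2) *\<^sub>R (p - y)" by (simp add: q_def algebra_simps flip: scaleR_left.add)
  then have pq: "dist p q = \<rho>" by (simp add: dist_norm \<rho>_def norm_minus_commute)
  have near: "cball p (\<rho> / 2) \<subseteq> ball x0 r"
  proof
    fix x assume "x \<in> cball p (\<rho> / 2)"
    then have "dist p x \<le> R / 4" using dyp by (simp add: \<rho>_def)
    moreover have "dist x0 x \<le> dist x0 y + dist y p + dist p x"
      using dist_triangle[of x0 x y] dist_triangle[of y x p] by linarith
    ultimately have "dist x0 x \<le> R + R + R / 4" using dyp by (simp add: R_def dist_commute)
    then have "dist x0 x < r" using R zero_le_dist[of x0 x] by linarith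
    then show "x \<in> ball x0 r" by simp
  qed
  show False
  proof (rule strong_minimum_principle_at_touching_ball[OF open_ball f ineq C \<rho> pq near])
    show "f p \<le> f x" if "x \<in> cball p (\<rho> / 2)" for x
      using that near min fp by (auto simp: subset_iff)
    show "f p < f x" if x: "x \<in> cball p (\<rho> / 2)" "x \<in> cball q \<rho>" "x \<noteq> p" for x
    proof -
      \<comment> \<open>parallelogram law around \<open>q\<close>, the midpoint of \<open>y\<close> and \<open>p\<close>: a point of the
        half-size ball other than \<open>p\<close> is strictly closer to \<open>y\<close> than \<open>p\<close> is\<close>
      have "(norm (x - y))\<^sup>2 + (norm (x - p))\<^sup>2 = 2 * (norm (x - q))\<^sup>2 + 2 * \<rho>\<^sup>2"
      proof -
        have a: "x - y = (x - q) + (p - q)" "x - p = (x - q) - (p - q)"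
          by (simp_all add: q_def algebra_simps flip: scaleR_left.add)
        have "(norm (b + c))\<^sup>2 + (norm (b - c))\<^sup>2 = 2 * (norm b)\<^sup>2 + 2 * (norm c)\<^sup>2"
          for b c :: "real^'n"
          by (simp add: power2_norm_eq_inner inner_add_left inner_add_right
              inner_diff_left inner_diff_right inner_commute)
        from this[of "x - q" "p - q"] show ?thesis
          using pq unfolding a by (simp add: dist_norm)
      qed
      moreover have "(norm (x - q))\<^sup>2 \<le> \<rho>\<^sup>2"
        using x(2) by (intro power_mono) (auto simp: dist_norm norm_minus_commute)
      moreover have "0 < (norm (x - p))\<^sup>2" using x(3) by simp
      ultimately have "(norm (x - y))\<^sup>2 < (2 * \<rho>)\<^sup>2" by (simp add: power2_eq_square)
      then have "norm (x - y) < 2 * \<rho>" using \<rho> by (auto intro: power2_less_imp_less)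
      then have lt: "dist y x < dist y p" by (simp add: \<rho>_def dist_norm norm_minus_commute)
      then have "x \<notin> Z" using p(2) by force
      then have "f x \<noteq> f x0" using lt dyp by (auto simp: Z_def)
      then show ?thesis
        using min[of x] near x(1) fp by force
    qed
  qed auto
qed

section \<open>The differential inequality\<close>

lemma dir_deriv_eq_gradient:
  fixes f :: "real^'n::finite \<Rightarrow> real"
  assumes "f differentiable (at x)"
  shows "dir_deriv v f x = v \<bullet> (\<chi> i. dir_deriv (axis i 1) f x)"
proof -
  have "dir_deriv v f x = dir_deriv (\<Sum>i\<in>UNIV. v $ i *\<^sub>R axis i 1) f x"
    using basis_expansion[of v] by (simp add: scalar_mult_eq_scaleR)
  also have "\<dots> = (\<Sum>i\<in>UNIV. v $ i * dir_deriv (axis i 1) f x)"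
    by (simp add: linear_sum[OF dir_deriv_lin[OF assms]] linear_cmul[OF dir_deriv_lin[OF assms]])
  finally show ?thesis by (simp add: inner_vec_def)
qed

lemma hessian_nth:
  fixes u :: "real^'n::finite \<Rightarrow> real"
  shows "hessian u x $ i $ j = dir_deriv (axis i 1) (dir_deriv (axis j 1) u) x"
proof -
  have "partial_deriv k w = dir_deriv (axis k 1) w" for k and w :: "real^'n \<Rightarrow> real"
    by (simp add: fun_eq_iff partial_deriv_def dir_deriv_def)
  then show ?thesis by (simp add: hessian_def)
qed

lemma dir_deriv2_eq_hessian:
  fixes f :: "real^'n::finite \<Rightarrow> real"
  assumes S: "open S" "smooth_on S f" "x \<in> S"
  shows "dir_deriv v (dir_deriv w f) x = v \<bullet> (hessian f x *v w)"
proof -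
  note d = smooth_on_differentiable[OF smooth_on_dir_deriv[OF S(2)] S(3)]
  have d': "(\<lambda>y. w $ j * dir_deriv (axis j 1) f y) differentiable (at x)" for j
    using d by (intro differentiable_mult) auto
  have "dir_deriv v (dir_deriv w f) x = dir_deriv v (\<lambda>y. \<Sum>j\<in>UNIV. w $ j * dir_deriv (axis j 1) f y) x"
    by (rule dir_deriv_cong[OF S(1,3)])
      (simp add: dir_deriv_eq_gradient[OF smooth_on_differentiable[OF S(2)], of _ w] inner_vec_def)
  also have "\<dots> = (\<Sum>j\<in>UNIV. w $ j * dir_deriv v (dir_deriv (axis j 1) f) x)"
    by (subst dir_deriv_sum) (auto simp: d' dir_deriv_mult d dir_deriv_const)
  also have "\<dots> = (\<Sum>j\<in>UNIV. \<Sum>i\<in>UNIV. v $ i * (hessian f x $ i $ j * w $ j))"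
    by (simp add: dir_deriv_eq_gradient[OF d, of v] hessian_nth inner_vec_def sum_distrib_left ac_simps)
  also have "\<dots> = (\<Sum>i\<in>UNIV. \<Sum>j\<in>UNIV. v $ i * (hessian f x $ i $ j * w $ j))"
    by (rule sum.swap)
  finally show ?thesis
    by (simp add: inner_vec_def matrix_vector_mult_def sum_distrib_left)
qed

text \<open>Rotation invariance of the Laplacian; it allows a frame adapted to each point.\<close>

lemma sum_dir_deriv2_frame:
  fixes f :: "real^'n::finite \<Rightarrow> real"
  assumes "open S" "smooth_on S f" "x \<in> S" "orthonormal_frame e"
  shows "(\<Sum>k\<in>UNIV. dir_deriv (e k) (dir_deriv (e k) f) x)
       = (\<Sum>k\<in>UNIV. dir_deriv (axis k 1) (dir_deriv (axis k 1) f) x)"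
  using trace_frame[OF assms(4), of "hessian f x"]
  by (simp add: dir_deriv2_eq_hessian[OF assms(1-3), of "e _" "e _"] trace_def hessian_nth)

lemma dir_deriv2_sum:
  fixes f :: "'i \<Rightarrow> 'a::real_normed_vector \<Rightarrow> real"
  assumes S: "open S" "x \<in> S" "\<And>i. i \<in> I \<Longrightarrow> smooth_on S (f i)"
  shows "dir_deriv v (dir_deriv w (\<lambda>y. \<Sum>i\<in>I. f i y)) x = (\<Sum>i\<in>I. dir_deriv v (dir_deriv w (f i)) x)"
proof -
  have "dir_deriv v (dir_deriv w (\<lambda>y. \<Sum>i\<in>I. f i y)) x = dir_deriv v (\<lambda>y. \<Sum>i\<in>I. dir_deriv w (f i) y) x"
    by (rule dir_deriv_cong[OF S(1,2)]) (auto intro!: dir_deriv_sum smooth_on_differentiable[OF S(3)])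
  also have "\<dots> = (\<Sum>i\<in>I. dir_deriv v (dir_deriv w (f i)) x)"
    by (rule dir_deriv_sum) (auto intro!: smooth_on_differentiable[OF smooth_on_dir_deriv[OF S(3)]] S(2))
  finally show ?thesis .
qed

lemma dir_deriv_square:
  fixes f :: "'a::real_normed_vector \<Rightarrow> real"
  assumes "f differentiable (at x)"
  shows "dir_deriv v (\<lambda>y. (f y)\<^sup>2) x = 2 * f x * dir_deriv v f x"
  using dir_deriv_mult[OF assms assms] by (simp add: power2_eq_square)

lemma dir_deriv2_square:
  fixes f :: "'a::real_normed_vector \<Rightarrow> real"
  assumes S: "open S" "x \<in> S" "smooth_on S f"
  shows "dir_deriv v (dir_deriv v (\<lambda>y. (f y)\<^sup>2)) x
    = 2 * (dir_deriv v f x)\<^sup>2 + 2 * f x * dir_deriv v (dir_deriv v f) x"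
proof -
  note d = smooth_on_differentiable[OF S(3)] smooth_on_differentiable[OF smooth_on_dir_deriv[OF S(3)]]
  have d2: "(\<lambda>y. 2 * f y) differentiable (at x)"
    using d(1)[OF S(2)] by (intro differentiable_mult) auto
  have "dir_deriv v (dir_deriv v (\<lambda>y. (f y)\<^sup>2)) x = dir_deriv v (\<lambda>y. (2 * f y) * dir_deriv v f y) x"
    by (rule dir_deriv_cong[OF S(1,2)]) (simp add: dir_deriv_square d)
  also have "\<dots> = 2 * (dir_deriv v f x)\<^sup>2 + 2 * f x * dir_deriv v (dir_deriv v f) x"
    by (simp add: dir_deriv_mult d d2 S(2) dir_deriv_const power2_eq_square)
  finally show ?thesis .
qed

lemma smooth_on_square:
  fixes f :: "'a::real_normed_vector \<Rightarrow> real"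
  shows "open S \<Longrightarrow> smooth_on S f \<Longrightarrow> smooth_on S (\<lambda>x. (f x)\<^sup>2)"
  by (simp add: power2_eq_square smooth_on_mult)

lemma dir_deriv_commute_third:
  fixes f :: "'a::real_normed_vector \<Rightarrow> real"
  assumes S: "open S" "smooth_on S f" "x \<in> S"
  shows "dir_deriv a (dir_deriv b (dir_deriv c f)) x = dir_deriv b (dir_deriv a (dir_deriv c f)) x"
    and "dir_deriv a (dir_deriv b (dir_deriv c f)) x = dir_deriv a (dir_deriv c (dir_deriv b f)) x"
proof -
  show "dir_deriv a (dir_deriv b (dir_deriv c f)) x = dir_deriv b (dir_deriv a (dir_deriv c f)) x"
    by (rule dir_deriv_commute[OF S(1) smooth_on_dir_deriv[OF S(2)] S(3)])
  show "dir_deriv a (dir_deriv b (dir_deriv c f)) x = dir_deriv a (dir_deriv c (dir_deriv b f)) x"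
    by (rule dir_deriv_cong[OF S(1,3)]) (rule dir_deriv_commute[OF S(1,2)])
qed

lemma dir_deriv_commute_fourth:
  fixes f :: "'a::real_normed_vector \<Rightarrow> real"
  assumes S: "open S" "smooth_on S f" "x \<in> S"
  shows "dir_deriv a (dir_deriv a (dir_deriv b (dir_deriv b f))) x = dir_deriv b (dir_deriv b (dir_deriv a (dir_deriv a f))) x"
proof -
  have t: "dir_deriv a (dir_deriv b (dir_deriv b g)) y = dir_deriv b (dir_deriv b (dir_deriv a g)) y"
    if "y \<in> S" "smooth_on S g" for y a b and g :: "'a \<Rightarrow> real"
    using dir_deriv_commute_third[OF S(1) that(2,1)] by metis
  have "dir_deriv a (dir_deriv a (dir_deriv b (dir_deriv b f))) x = dir_deriv a (dir_deriv b (dir_deriv b (dir_deriv a f))) x"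
    by (rule dir_deriv_cong[OF S(1,3)]) (rule t[OF _ S(2)])
  also have "\<dots> = dir_deriv b (dir_deriv b (dir_deriv a (dir_deriv a f))) x"
    by (rule t[OF S(3) smooth_on_dir_deriv[OF S(2)]])
  finally show ?thesis .
qed

text \<open>For \<open>a \<noteq> k\<close> the value \<open>T k a a\<close> occurs at the three distinct positions \<open>(k, a, a)\<close>,
  \<open>(a, k, a)\<close> and \<open>(a, a, k)\<close> of the tensor, whereas \<open>T k k k\<close> occurs once; the entries with
  three different indices are dropped.\<close>

lemma symmetric_tensor_norm_lower_bound:
  fixes T :: "'n::finite \<Rightarrow> 'n \<Rightarrow> 'n \<Rightarrow> real"
  assumes sym: "\<And>a b c. T a b c = T b a c" "\<And>a b c. T a b c = T a c b"
  shows "(\<Sum>k\<in>UNIV. (T k k k)\<^sup>2 + 3 * (\<Sum>a\<in>-{k}. (T k a a)\<^sup>2))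
       \<le> (\<Sum>k\<in>UNIV. \<Sum>a\<in>UNIV. \<Sum>b\<in>UNIV. (T k a b)\<^sup>2)"
proof -
  have split: "sum f UNIV = f k + sum f (-{k})" for f :: "'n \<Rightarrow> real" and k
    by (simp add: Compl_eq_Diff_UNIV sum.remove[of UNIV k])
  have swap: "(\<Sum>k\<in>UNIV. \<Sum>a\<in>-{k}. f a k) = (\<Sum>k\<in>UNIV. \<Sum>a\<in>-{k}. f k a)"
    for f :: "'n \<Rightarrow> 'n \<Rightarrow> real"
  proof -
    have c: "(\<Sum>a\<in>-{k}. g a) = (\<Sum>a\<in>UNIV. if a = k then 0 else g a)" for k and g :: "'n \<Rightarrow> real"
      by (rule sum.mono_neutral_cong_left) auto
    show ?thesis
      unfolding c by (subst sum.swap) (auto intro!: sum.cong)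
  qed
  have "(\<Sum>k\<in>UNIV. (T k k k)\<^sup>2 + 3 * (\<Sum>a\<in>-{k}. (T k a a)\<^sup>2))
      = (\<Sum>k\<in>UNIV. (T k k k)\<^sup>2 + (\<Sum>a\<in>-{k}. (T k a a)\<^sup>2))
        + 2 * (\<Sum>k\<in>UNIV. \<Sum>a\<in>-{k}. (T k a a)\<^sup>2)"
    by (simp add: sum.distrib sum_distrib_left[symmetric])
  also have "(\<Sum>k\<in>UNIV. \<Sum>a\<in>-{k}. (T k a a)\<^sup>2) = (\<Sum>k\<in>UNIV. \<Sum>a\<in>-{k}. (T k k a)\<^sup>2)"
  proof -
    have "T a k k = T k k a" for a k using sym by metis
    then show ?thesis by (subst swap[symmetric]) simp
  qed
  also have "(\<Sum>k\<in>UNIV. (T k k k)\<^sup>2 + (\<Sum>a\<in>-{k}. (T k a a)\<^sup>2))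
        + 2 * (\<Sum>k\<in>UNIV. \<Sum>a\<in>-{k}. (T k k a)\<^sup>2)
      = (\<Sum>k\<in>UNIV. (\<Sum>b\<in>UNIV. (T k k b)\<^sup>2) + (\<Sum>a\<in>-{k}. (T k a a)\<^sup>2 + (T k a k)\<^sup>2))"
  proof -
    have "T k a k = T k k a" for a k using sym by metis
    moreover have "(\<Sum>b\<in>UNIV. (T k k b)\<^sup>2) = (T k k k)\<^sup>2 + (\<Sum>b\<in>-{k}. (T k k b)\<^sup>2)" for k
      by (rule split)
    ultimately show ?thesis
      by (simp add: sum.distrib sum_distrib_left)
  qed
  also have "\<dots> \<le> (\<Sum>k\<in>UNIV. \<Sum>a\<in>UNIV. \<Sum>b\<in>UNIV. (T k a b)\<^sup>2)"
  proof (rule sum_mono)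
    fix k
    have "(\<Sum>a\<in>-{k}. (T k a a)\<^sup>2 + (T k a k)\<^sup>2) \<le> (\<Sum>a\<in>-{k}. \<Sum>b\<in>UNIV. (T k a b)\<^sup>2)"
    proof (rule sum_mono)
      fix a assume "a \<in> -{k}"
      then have "(T k a a)\<^sup>2 + (T k a k)\<^sup>2 = (\<Sum>b\<in>{a, k}. (T k a b)\<^sup>2)" by simp
      also have "\<dots> \<le> (\<Sum>b\<in>UNIV. (T k a b)\<^sup>2)" by (rule sum_mono2) auto
      finally show "(T k a a)\<^sup>2 + (T k a k)\<^sup>2 \<le> (\<Sum>b\<in>UNIV. (T k a b)\<^sup>2)" .
    qed
    then show "(\<Sum>b\<in>UNIV. (T k k b)\<^sup>2) + (\<Sum>a\<in>-{k}. (T k a a)\<^sup>2 + (T k a k)\<^sup>2)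
        \<le> (\<Sum>a\<in>UNIV. \<Sum>b\<in>UNIV. (T k a b)\<^sup>2)"
      by (simp add: split[of "\<lambda>a. \<Sum>b\<in>UNIV. (T _ a b)\<^sup>2" k])
  qed
  finally show ?thesis .
qed

text \<open>Cauchy-Schwarz with weights \<open>1\<close> at \<open>k\<close> and \<open>3\<close> elsewhere, the multiplicities of the entries in
  a symmetric tensor, followed by \<open>\<Sum> l\<^sub>a\<^sup>2 \<le> (\<Sum> l\<^sub>a)\<^sup>2\<close> over the indices \<open>a \<noteq> k\<close>.\<close>

lemma weighted_cauchy_schwarz:
  fixes l x :: "'n::finite \<Rightarrow> real"
  assumes "\<And>a. 0 \<le> l a"
  shows "(\<Sum>a\<in>UNIV. l a * x a)\<^sup>2
    \<le> ((l k)\<^sup>2 + (sum l UNIV - l k)\<^sup>2 / 3) * ((x k)\<^sup>2 + 3 * (\<Sum>a\<in>-{k}. (x a)\<^sup>2))"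
proof -
  have split: "sum f UNIV = f k + sum f (-{k})" for f :: "'n \<Rightarrow> real"
    by (simp add: Compl_eq_Diff_UNIV sum.remove[of UNIV k])
  define c where "c = (\<lambda>a. if a = k then 1 else sqrt 3)"
  have c: "c a > 0" "(c a)\<^sup>2 = (if a = k then 1 else 3)" for a by (auto simp: c_def)
  have "(\<Sum>a\<in>UNIV. l a * x a) = (\<Sum>a\<in>UNIV. (l a / c a) * (c a * x a))"
    using c(1) by (intro sum.cong) (auto simp: less_imp_neq[symmetric])
  then have "(\<Sum>a\<in>UNIV. l a * x a)\<^sup>2
      \<le> (\<Sum>a\<in>UNIV. (l a / c a)\<^sup>2) * (\<Sum>a\<in>UNIV. (c a * x a)\<^sup>2)"
    using Cauchy_Schwarz_ineq_sum by metis
  also have "(\<Sum>a\<in>UNIV. (c a * x a)\<^sup>2) = (x k)\<^sup>2 + 3 * (\<Sum>a\<in>-{k}. (x a)\<^sup>2)"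
    by (subst split) (simp add: power_mult_distrib c(2) sum_distrib_left)
  also have "(\<Sum>a\<in>UNIV. (l a / c a)\<^sup>2) = (l k)\<^sup>2 + (\<Sum>a\<in>-{k}. (l a)\<^sup>2) / 3"
    by (subst split) (simp add: power_divide c(2) sum_divide_distrib)
  finally have 1: "(\<Sum>a\<in>UNIV. l a * x a)\<^sup>2
      \<le> ((l k)\<^sup>2 + (\<Sum>a\<in>-{k}. (l a)\<^sup>2) / 3) * ((x k)\<^sup>2 + 3 * (\<Sum>a\<in>-{k}. (x a)\<^sup>2))" .
  have "(\<Sum>a\<in>-{k}. (l a)\<^sup>2) \<le> (\<Sum>a\<in>-{k}. l a * sum l (-{k}))"
    unfolding power2_eq_square using assms
    by (intro sum_mono mult_left_mono member_le_sum) auto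
  also have "\<dots> = (sum l UNIV - l k)\<^sup>2"
    by (simp add: split[of l] power2_eq_square sum_distrib_right)
  finally have "(l k)\<^sup>2 + (\<Sum>a\<in>-{k}. (l a)\<^sup>2) / 3 \<le> (l k)\<^sup>2 + (sum l UNIV - l k)\<^sup>2 / 3" by simp
  moreover have "0 \<le> (x k)\<^sup>2 + 3 * (\<Sum>a\<in>-{k}. (x a)\<^sup>2)" by (simp add: sum_nonneg)
  ultimately show ?thesis using 1 mult_right_mono by (meson order_trans)
qed

text \<open>The difference of the two sides is \<open>8/3 m (g - m)\<^sup>2\<close>. The first factor is \<open>g + A (g - m)\<close> for
  \<open>A = 2\<close>; as both sides agree at \<open>m = 0\<close>, no larger \<open>A\<close> would do.\<close>

lemma cubic_eigenvalue_inequality: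
  fixes g m :: real
  assumes "0 \<le> m" "m \<le> g"
  shows "(3 * g - 2 * m) * (m\<^sup>2 + (g - m)\<^sup>2 / 3) \<le> g ^ 3"
proof -
  have "g ^ 3 - (3 * g - 2 * m) * (m\<^sup>2 + (g - m)\<^sup>2 / 3) = 8 / 3 * m * (g - m)\<^sup>2"
    by (simp add: power2_eq_square power3_eq_cube field_simps)
  also have "\<dots> \<ge> 0" using assms by simp
  finally show ?thesis by simp
qed

text \<open>In the application \<open>p\<close> is the \<open>k\<close>-th derivative of \<open>g\<close>, \<open>x\<close> the list of third derivatives
  \<open>u\<^sub>k\<^sub>a\<^sub>a\<close>, and \<open>2 \<beta>\<close> the \<open>k\<close>-th derivative of \<open>(tr H)\<^sup>2 - |H|\<^sup>2\<close>. For \<open>\<beta> = 0\<close> the right-hand side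
  vanishes, and Cauchy-Schwarz combined with the cubic inequality is exactly the claim; for
  general \<open>\<beta>\<close> use \<open>(g p - \<beta>)\<^sup>2 \<ge> (g p)\<^sup>2 - 2 g |p| |\<beta>|\<close>.\<close>

lemma third_derivative_absorption:
  fixes l x :: "'n::finite \<Rightarrow> real"
  assumes l: "\<And>a. 0 \<le> l a" and g: "0 < g" "sum l UNIV = g"
    and eq: "g * p - (\<Sum>a\<in>UNIV. l a * x a) = \<beta>"
  shows "p\<^sup>2 * (3 - 2 * l k / g) - ((x k)\<^sup>2 + 3 * (\<Sum>a\<in>-{k}. (x a)\<^sup>2)) \<le> 6 * \<bar>p\<bar> * \<bar>\<beta>\<bar> / g"
proof -
  define Q where "Q = (x k)\<^sup>2 + 3 * (\<Sum>a\<in>-{k}. (x a)\<^sup>2)"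
  have Q: "0 \<le> Q" by (simp add: Q_def sum_nonneg)
  have lk: "0 \<le> l k" "l k \<le> g"
    using l member_le_sum[of k UNIV l] g by auto
  have "(3 * g - 2 * l k) * (g * p - \<beta>)\<^sup>2
      \<le> (3 * g - 2 * l k) * (((l k)\<^sup>2 + (g - l k)\<^sup>2 / 3) * Q)"
    using weighted_cauchy_schwarz[of l x k] l lk g eq unfolding Q_def
    by (intro mult_left_mono) auto
  also have "\<dots> \<le> g ^ 3 * Q"
    using mult_right_mono[OF cubic_eigenvalue_inequality[OF lk] Q] by (simp add: mult.assoc)
  finally have 1: "(3 * g - 2 * l k) * (g * p - \<beta>)\<^sup>2 \<le> g ^ 3 * Q" .
  have "(g * p)\<^sup>2 - 2 * g * (\<bar>p\<bar> * \<bar>\<beta>\<bar>) \<le> (g * p - \<beta>)\<^sup>2"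
  proof -
    have "g * (p * \<beta>) \<le> g * (\<bar>p\<bar> * \<bar>\<beta>\<bar>)"
      using g(1) by (intro mult_left_mono) (auto simp flip: abs_mult)
    moreover have "(g * p - \<beta>)\<^sup>2 = (g * p)\<^sup>2 - 2 * (g * (p * \<beta>)) + \<beta>\<^sup>2"
      by (simp add: power2_eq_square algebra_simps)
    ultimately show ?thesis using zero_le_power2[of \<beta>] by linarith
  qed
  then have "(3 * g - 2 * l k) * ((g * p)\<^sup>2 - 2 * g * (\<bar>p\<bar> * \<bar>\<beta>\<bar>)) \<le> g ^ 3 * Q"
    using 1 lk mult_left_mono[of _ _ "3 * g - 2 * l k"] by (smt (verit))
  then have "(3 * g - 2 * l k) * (g * p)\<^sup>2 - g ^ 3 * Q
      \<le> (3 * g - 2 * l k) * (2 * g * (\<bar>p\<bar> * \<bar>\<beta>\<bar>))"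
    by (simp add: right_diff_distrib)
  also have "\<dots> \<le> (3 * g) * (2 * g * (\<bar>p\<bar> * \<bar>\<beta>\<bar>))"
    using lk g(1) by (intro mult_right_mono) auto
  finally have 2: "((3 * g - 2 * l k) * (g * p)\<^sup>2 - g ^ 3 * Q) / g ^ 3
      \<le> ((3 * g) * (2 * g * (\<bar>p\<bar> * \<bar>\<beta>\<bar>))) / g ^ 3"
    using g(1) by (intro divide_right_mono) auto
  have "((3 * g - 2 * l k) * (g * p)\<^sup>2 - g ^ 3 * Q) / g ^ 3 = p\<^sup>2 * (3 - 2 * l k / g) - Q"
    using g(1) by (simp add: field_simps power2_eq_square power3_eq_cube)
  moreover have "((3 * g) * (2 * g * (\<bar>p\<bar> * \<bar>\<beta>\<bar>))) / g ^ 3 = 6 * \<bar>p\<bar> * \<bar>\<beta>\<bar> / g"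
    using g(1) by (simp add: field_simps power2_eq_square power3_eq_cube)
  ultimately show ?thesis using 2 by (simp add: Q_def)
qed

text \<open>The hypothesis gives \<open>g2 \<le> 2 g1\<^sup>2 / g\<close>, and \<open>g - m\<close> is nonnegative.\<close>

lemma nonlinearity_absorption:
  fixes g g1 g2 A m v :: real
  assumes "0 < g" "0 \<le> m" "m \<le> g" "A \<le> 2" "g * g2 \<le> A * g1\<^sup>2"
  shows "(g1 * v)\<^sup>2 + (g - m) * (g2 * v\<^sup>2) \<le> (g1 * v)\<^sup>2 * (3 - 2 * m / g)"
proof -
  have "g * g2 \<le> 2 * g1\<^sup>2"
    using assms(4,5) mult_right_mono[of A 2 "g1\<^sup>2"] by simp
  then have "g2 \<le> 2 * g1\<^sup>2 / g"
    using assms(1) by (simp add: pos_le_divide_eq mult.commute)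
  then have "(g - m) * v\<^sup>2 * g2 \<le> (g - m) * v\<^sup>2 * (2 * g1\<^sup>2 / g)"
    using assms by (intro mult_left_mono) auto
  moreover have "(g - m) * v\<^sup>2 * (2 * g1\<^sup>2 / g) = (g1 * v)\<^sup>2 * (2 - 2 * m / g)"
    using assms(1) by (simp add: field_simps power2_eq_square)
  ultimately show ?thesis by (simp add: algebra_simps)
qed

text \<open>This is \<open>2 \<sigma>\<^sub>2\<close> of the Hessian, written as a polynomial in its entries: in this form it is
  visibly smooth, and it has the same expression in every orthonormal frame.\<close>

definition hessian_defect :: "(real^'n::finite \<Rightarrow> real) \<Rightarrow> real^'n \<Rightarrow> real" where
  "hessian_defect u x = (trace (hessian u x))\<^sup>2 - (\<Sum>i\<in>UNIV. \<Sum>j\<in>UNIV. (hessian u x $ i $ j)\<^sup>2)"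

lemma smooth_on_hessian_defect:
  assumes "open S" "smooth_on S u"
  shows "smooth_on S (hessian_defect u)"
  unfolding hessian_defect_def[abs_def] trace_def hessian_nth
  using assms by (intro smooth_on_diff smooth_on_square smooth_on_sum smooth_on_dir_deriv)

lemma hessian_defect_frame:
  fixes u :: "real^'n::finite \<Rightarrow> real"
  assumes "open S" "smooth_on S u" "x \<in> S" "orthonormal_frame e"
  shows "hessian_defect u x = (\<Sum>a\<in>UNIV. dir_deriv (e a) (dir_deriv (e a) u) x)\<^sup>2
      - (\<Sum>a\<in>UNIV. \<Sum>b\<in>UNIV. (dir_deriv (e a) (dir_deriv (e b) u) x)\<^sup>2)"
  using trace_frame[OF assms(4), of "hessian u x"] sum_squares_frame[OF assms(4), of "hessian u x"]
  by (simp add: hessian_defect_def dir_deriv2_eq_hessian[OF assms(1-3)])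

text \<open>The computation is done at the fixed point \<open>x\<close> in directions \<open>e k\<close> that diagonalize the
  Hessian there. The frame does not move with the point, so \<open>U a b\<close> is diagonal only at \<open>x\<close>, but
  \<open>F = h\<^sup>2 - \<Sum> U\<^sub>a\<^sub>b\<^sup>2\<close> and \<open>h = G(u)\<close> hold on all of \<open>\<Omega>\<close> and may be differentiated.\<close>

lemma laplacian_hessian_defect_le:
  fixes u :: "real^'n::finite \<Rightarrow> real"
  assumes \<Omega>: "open \<Omega>" and G: "smooth_on UNIV G" "\<And>t. 0 < G t"
    and A: "A \<le> 2" "\<And>t. G t * deriv (deriv G) t \<le> A * (deriv G t)\<^sup>2"
    and u: "smooth_on \<Omega> u" "\<And>x. x \<in> \<Omega> \<Longrightarrow> positive_semidefinite (hessian u x)"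
      "\<And>x. x \<in> \<Omega> \<Longrightarrow> laplacian u x = G (u x)"
    and x: "x \<in> \<Omega>"
  shows "(\<Sum>k\<in>UNIV. dir_deriv (axis k 1) (dir_deriv (axis k 1) (hessian_defect u)) x)
    \<le> 2 * deriv G (u x) * hessian_defect u x
      + 6 * CARD('n) * norm (\<chi> k. dir_deriv (axis k 1) (\<lambda>y. G (u y)) x) / G (u x)
        * norm (\<chi> k. dir_deriv (axis k 1) (hessian_defect u) x)"
proof -
  obtain e l where e: "orthonormal_frame e" and l: "\<And>a. hessian u x *v e a = l a *\<^sub>R e a"
    using symmetric_matrix_eigenframe u(2)[OF x] unfolding positive_semidefinite_def by metis
  define U where "U = (\<lambda>a b. dir_deriv (e a) (dir_deriv (e b) u))"
  define h where "h = (\<lambda>y. \<Sum>a\<in>UNIV. U a a y)"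
  define F where "F = hessian_defect u"
  define T where "T = (\<lambda>k a b. dir_deriv (e k) (U a b) x)"
  define g g1 g2 where "g = G (u x)" and "g1 = deriv G (u x)" and "g2 = deriv (deriv G) (u x)"
  define p where "p = (\<lambda>k. dir_deriv (e k) h x)"
  define v where "v = (\<lambda>k. dir_deriv (e k) u x)"
  have Us: "smooth_on \<Omega> (U a b)" for a b
    unfolding U_def by (intro smooth_on_dir_deriv u)
  have hs: "smooth_on \<Omega> h"
    unfolding h_def by (intro smooth_on_sum \<Omega> Us)
  have Fs: "smooth_on \<Omega> F"
    unfolding F_def by (rule smooth_on_hessian_defect[OF \<Omega> u(1)])
  note d = smooth_on_differentiable[OF Us] smooth_on_differentiable[OF hs]
    smooth_on_differentiable[OF u(1)] smooth_on_differentiable[OF smooth_on_dir_deriv[OF u(1)]]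
  have hG: "h y = G (u y)" if "y \<in> \<Omega>" for y
    using trace_frame[OF e, of "hessian u y"] u(3)[OF that]
    by (simp add: h_def U_def dir_deriv2_eq_hessian[OF \<Omega> u(1) that] laplacian_def)
  have Ux: "U a b x = (if a = b then l a else 0)" for a b
    using e by (simp add: U_def dir_deriv2_eq_hessian[OF \<Omega> u(1) x] l orthonormal_frame_def)
  have l0: "0 \<le> l a" for a
    using frame_quadratic_eigen(3)[OF e l u(2)[OF x]] .
  have lsum: "sum l UNIV = g"
    using hG[OF x] by (simp add: h_def Ux g_def)
  have gpos: "0 < g" using G(2) by (simp add: g_def)
  have Gd: "G differentiable (at t)" "deriv G differentiable (at t)" for t
    using smooth_on_differentiable G(1) smooth_on_deriv by blast+
  have dh: "dir_deriv w h y = deriv G (u y) * dir_deriv w u y" if "y \<in> \<Omega>" for w y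
  proof -
    have "dir_deriv w h y = dir_deriv w (\<lambda>y. G (u y)) y"
      by (rule dir_deriv_cong[OF \<Omega> that hG])
    then show ?thesis
      using dir_deriv_compose_real(1)[OF d(3)[OF that] Gd(1)] by simp
  qed
  have pv: "p k = g1 * v k" for k
    using dh[OF x] by (simp add: p_def g1_def v_def)
  have ddh: "dir_deriv (e k) (dir_deriv (e k) h) x = g2 * (v k)\<^sup>2 + g1 * l k" for k
  proof -
    have "dir_deriv (e k) (dir_deriv (e k) h) x
        = dir_deriv (e k) (\<lambda>y. deriv G (u y) * dir_deriv (e k) u y) x"
      by (rule dir_deriv_cong[OF \<Omega> x dh])
    also have "\<dots> = g2 * (v k)\<^sup>2 + g1 * U k k x"
      using dir_deriv_compose_real[OF d(3)[OF x] Gd(2)] d(4)[OF x]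
      by (simp add: dir_deriv_mult g1_def g2_def v_def U_def power2_eq_square)
    finally show ?thesis by (simp add: Ux)
  qed
  have F_eq: "F y = (h y)\<^sup>2 - (\<Sum>a\<in>UNIV. \<Sum>b\<in>UNIV. (U a b y)\<^sup>2)" if "y \<in> \<Omega>" for y
    using hessian_defect_frame[OF \<Omega> u(1) that e] by (simp add: F_def h_def U_def)
  let ?N = "\<lambda>y. \<Sum>a\<in>UNIV. \<Sum>b\<in>UNIV. (U a b y)\<^sup>2"
  have Usq: "smooth_on \<Omega> (\<lambda>y. (U a b y)\<^sup>2)" for a b
    by (rule smooth_on_square[OF \<Omega> Us])
  have Ns1: "smooth_on \<Omega> (\<lambda>y. \<Sum>b\<in>UNIV. (U a b y)\<^sup>2)" for a
    by (intro smooth_on_sum \<Omega> Usq)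
  have Ns: "smooth_on \<Omega> ?N"
    by (intro smooth_on_sum \<Omega> Usq)
  have hsq: "smooth_on \<Omega> (\<lambda>y. (h y)\<^sup>2)"
    by (rule smooth_on_square[OF \<Omega> hs])
  \<comment> \<open>at \<open>x\<close> only the diagonal entries of \<open>U\<close> survive\<close>
  have diag: "(\<Sum>a\<in>UNIV. \<Sum>b\<in>UNIV. U a b x * W a b) = (\<Sum>a\<in>UNIV. l a * W a a)" for W
    by (simp add: Ux if_distrib[of "\<lambda>c. c * _"] cong: if_cong)
  have dF: "dir_deriv (e k) F y = dir_deriv (e k) (\<lambda>y. (h y)\<^sup>2) y - dir_deriv (e k) ?N y"
    if "y \<in> \<Omega>" for k y
    using dir_deriv_cong[OF \<Omega> that F_eq]
      dir_deriv_diff[OF smooth_on_differentiable[OF hsq that] smooth_on_differentiable[OF Ns that]]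
    by simp
  have dFx: "dir_deriv (e k) F x / 2 = g * p k - (\<Sum>a\<in>UNIV. l a * T k a a)" for k
  proof -
    have "dir_deriv (e k) ?N x = (\<Sum>a\<in>UNIV. \<Sum>b\<in>UNIV. dir_deriv (e k) (\<lambda>y. (U a b y)\<^sup>2) x)"
      using x smooth_on_differentiable[OF Ns1] smooth_on_differentiable[OF Usq]
      by (simp add: dir_deriv_sum)
    also have "\<dots> = 2 * (\<Sum>a\<in>UNIV. \<Sum>b\<in>UNIV. U a b x * T k a b)"
      by (simp add: dir_deriv_square d(1)[OF x] T_def sum_distrib_left mult.assoc)
    finally show ?thesis
      using dF[OF x] hG[OF x] by (simp add: diag dir_deriv_square d(2)[OF x] p_def g_def)
  qed
  have ddF: "dir_deriv (e k) (dir_deriv (e k) F) x = 2 * (p k)\<^sup>2 + 2 * g * (g2 * (v k)\<^sup>2 + g1 * l k)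
      - 2 * (\<Sum>a\<in>UNIV. \<Sum>b\<in>UNIV. (T k a b)\<^sup>2)
      - 2 * (\<Sum>a\<in>UNIV. l a * dir_deriv (e k) (dir_deriv (e k) (U a a)) x)" for k
  proof -
    have "dir_deriv (e k) (dir_deriv (e k) F) x
        = dir_deriv (e k) (\<lambda>y. dir_deriv (e k) (\<lambda>y. (h y)\<^sup>2) y - dir_deriv (e k) ?N y) x"
      by (rule dir_deriv_cong[OF \<Omega> x dF])
    also have "\<dots> = dir_deriv (e k) (dir_deriv (e k) (\<lambda>y. (h y)\<^sup>2)) x - dir_deriv (e k) (dir_deriv (e k) ?N) x"
      by (rule dir_deriv_diff) (intro smooth_on_differentiable[OF smooth_on_dir_deriv x] hsq Ns)+
    also have "dir_deriv (e k) (dir_deriv (e k) (\<lambda>y. (h y)\<^sup>2)) x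
        = 2 * (p k)\<^sup>2 + 2 * g * (g2 * (v k)\<^sup>2 + g1 * l k)"
      using hG[OF x] by (simp add: dir_deriv2_square[OF \<Omega> x hs] ddh p_def g_def)
    also have "dir_deriv (e k) (dir_deriv (e k) ?N) x
        = (\<Sum>a\<in>UNIV. \<Sum>b\<in>UNIV. dir_deriv (e k) (dir_deriv (e k) (\<lambda>y. (U a b y)\<^sup>2)) x)"
      by (simp add: dir_deriv2_sum[OF \<Omega> x Ns1] dir_deriv2_sum[OF \<Omega> x Usq])
    also have "\<dots> = 2 * (\<Sum>a\<in>UNIV. \<Sum>b\<in>UNIV. (T k a b)\<^sup>2)
        + 2 * (\<Sum>a\<in>UNIV. \<Sum>b\<in>UNIV. U a b x * dir_deriv (e k) (dir_deriv (e k) (U a b)) x)"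
      by (simp add: dir_deriv2_square[OF \<Omega> x Us] T_def sum.distrib sum_distrib_left mult.assoc)
    finally show ?thesis by (simp add: diag)
  qed
  \<comment> \<open>the trace of the fourth derivatives: differentiate \<open>\<Delta>u = h\<close> twice in direction \<open>e a\<close>\<close>
  have fourth: "(\<Sum>k\<in>UNIV. dir_deriv (e k) (dir_deriv (e k) (U a a)) x) = g2 * (v a)\<^sup>2 + g1 * l a" for a
  proof -
    have "(\<Sum>k\<in>UNIV. dir_deriv (e k) (dir_deriv (e k) (U a a)) x)
        = (\<Sum>k\<in>UNIV. dir_deriv (e a) (dir_deriv (e a) (U k k)) x)"
      unfolding U_def by (intro sum.cong refl dir_deriv_commute_fourth[OF \<Omega> u(1) x])
    also have "\<dots> = dir_deriv (e a) (dir_deriv (e a) h) x"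
      unfolding h_def by (rule dir_deriv2_sum[OF \<Omega> x Us, symmetric])
    finally show ?thesis by (simp add: ddh)
  qed
  define N3 where "N3 = (\<Sum>k\<in>UNIV. \<Sum>a\<in>UNIV. \<Sum>b\<in>UNIV. (T k a b)\<^sup>2)"
  have Fx: "F x = g\<^sup>2 - (\<Sum>a\<in>UNIV. (l a)\<^sup>2)"
    using F_eq[OF x] hG[OF x]
    by (simp add: g_def Ux if_distrib[of "\<lambda>c. c\<^sup>2"] cong: if_cong)
  have main_eq: "(\<Sum>k\<in>UNIV. dir_deriv (e k) (dir_deriv (e k) F) x) / 2
      = (\<Sum>k\<in>UNIV. (p k)\<^sup>2 + (g - l k) * (g2 * (v k)\<^sup>2)) + g1 * F x - N3"
  proof -
    have "(\<Sum>k\<in>UNIV. \<Sum>a\<in>UNIV. l a * dir_deriv (e k) (dir_deriv (e k) (U a a)) x)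
        = (\<Sum>a\<in>UNIV. l a * (g2 * (v a)\<^sup>2 + g1 * l a))"
      by (subst sum.swap) (simp add: sum_distrib_left[symmetric] fourth)
    moreover have "(\<Sum>k\<in>UNIV. dir_deriv (e k) (dir_deriv (e k) F) x) / 2
        = (\<Sum>k\<in>UNIV. (p k)\<^sup>2 + g * (g2 * (v k)\<^sup>2 + g1 * l k)) - N3
          - (\<Sum>k\<in>UNIV. \<Sum>a\<in>UNIV. l a * dir_deriv (e k) (dir_deriv (e k) (U a a)) x)"
      by (simp add: ddF N3_def sum.distrib sum_subtractf sum_divide_distrib add_divide_distrib
          diff_divide_distrib sum_distrib_left[symmetric])
    moreover have "(\<Sum>k\<in>UNIV. (p k)\<^sup>2 + g * (g2 * (v k)\<^sup>2 + g1 * l k))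
          - (\<Sum>a\<in>UNIV. l a * (g2 * (v a)\<^sup>2 + g1 * l a))
        = (\<Sum>k\<in>UNIV. (p k)\<^sup>2 + (g - l k) * (g2 * (v k)\<^sup>2)) + g1 * F x"
    proof -
      have "(\<Sum>k\<in>UNIV. (p k)\<^sup>2 + g * (g2 * (v k)\<^sup>2 + g1 * l k))
            - (\<Sum>a\<in>UNIV. l a * (g2 * (v a)\<^sup>2 + g1 * l a))
          = (\<Sum>k\<in>UNIV. ((p k)\<^sup>2 + (g - l k) * (g2 * (v k)\<^sup>2)) + g1 * (g * l k - (l k)\<^sup>2))"
        unfolding sum_subtractf[symmetric]
        by (intro sum.cong refl) (simp add: algebra_simps power2_eq_square)
      also have "\<dots> = (\<Sum>k\<in>UNIV. (p k)\<^sup>2 + (g - l k) * (g2 * (v k)\<^sup>2))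
            + (\<Sum>k\<in>UNIV. g1 * (g * l k - (l k)\<^sup>2))"
        by (rule sum.distrib)
      also have "(\<Sum>k\<in>UNIV. g1 * (g * l k - (l k)\<^sup>2)) = g1 * (g * sum l UNIV - (\<Sum>k\<in>UNIV. (l k)\<^sup>2))"
        by (simp add: sum_subtractf flip: sum_distrib_left)
      finally show ?thesis by (simp add: Fx lsum power2_eq_square)
    qed
    ultimately show ?thesis by linarith
  qed
  have halved_bound: "D \<le> 2 * y * z + X" if "s - N \<le> X / 2" "D / 2 = s + y * z - N"
    for D s N y z X :: real
    using that by (simp add: field_simps)
  have Tsym: "T a b c = T b a c" "T a b c = T a c b" for a b c
    unfolding T_def U_def using dir_deriv_commute_third[OF \<Omega> u(1) x] by blast+
  have lg: "l k \<le> g" for k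
    using member_le_sum[of k UNIV l] l0 lsum by auto
  let ?gF = "\<chi> k. dir_deriv (axis k 1) F x" and ?gh = "\<chi> k. dir_deriv (axis k 1) h x"
  have ek: "norm (e k) = 1" for k
    using e by (simp add: orthonormal_frame_def norm_eq_1)
  have pk: "\<bar>p k\<bar> \<le> norm ?gh" for k
    using Cauchy_Schwarz_ineq2[of "e k" ?gh]
    by (simp add: p_def dir_deriv_eq_gradient[OF d(2)[OF x], of "e k"] ek)
  have Fk: "\<bar>dir_deriv (e k) F x\<bar> \<le> norm ?gF" for k
    using Cauchy_Schwarz_ineq2[of "e k" ?gF]
    by (simp add: dir_deriv_eq_gradient[OF smooth_on_differentiable[OF Fs x], of "e k"] ek)
  have "(\<Sum>k\<in>UNIV. (p k)\<^sup>2 + (g - l k) * (g2 * (v k)\<^sup>2)) - N3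
      \<le> (\<Sum>k\<in>UNIV. (p k)\<^sup>2 * (3 - 2 * l k / g))
        - (\<Sum>k\<in>UNIV. (T k k k)\<^sup>2 + 3 * (\<Sum>a\<in>-{k}. (T k a a)\<^sup>2))"
    unfolding N3_def pv
    using A(2)[of "u x"]
    by (intro diff_mono sum_mono nonlinearity_absorption[OF gpos l0 lg A(1)]
        symmetric_tensor_norm_lower_bound Tsym) (simp add: g_def g1_def g2_def)
  also have "\<dots> = (\<Sum>k\<in>UNIV. (p k)\<^sup>2 * (3 - 2 * l k / g)
        - ((T k k k)\<^sup>2 + 3 * (\<Sum>a\<in>-{k}. (T k a a)\<^sup>2)))"
    by (simp add: sum_subtractf)
  also have "\<dots> \<le> (\<Sum>k\<in>UNIV. 6 * \<bar>p k\<bar> * \<bar>dir_deriv (e k) F x / 2\<bar> / g)"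
    by (intro sum_mono third_derivative_absorption[OF l0 gpos lsum] dFx[symmetric])
  also have "\<dots> \<le> (\<Sum>k\<in>(UNIV::'n set). 6 * norm ?gh * (norm ?gF / 2) / g)"
    using pk Fk gpos by (intro sum_mono divide_right_mono mult_mono) auto
  also have "\<dots> = (6 * CARD('n) * norm ?gh / g * norm ?gF) / 2"
    by simp
  finally have "(\<Sum>k\<in>UNIV. dir_deriv (e k) (dir_deriv (e k) F) x)
      \<le> 2 * g1 * F x + 6 * CARD('n) * norm ?gh / g * norm ?gF"
    by (rule halved_bound[OF _ main_eq])
  moreover have "(\<Sum>k\<in>UNIV. dir_deriv (e k) (dir_deriv (e k) F) x)
      = (\<Sum>k\<in>UNIV. dir_deriv (axis k 1) (dir_deriv (axis k 1) F) x)"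
    by (rule sum_dir_deriv2_frame[OF \<Omega> Fs x e])
  moreover have "dir_deriv w h x = dir_deriv w (\<lambda>y. G (u y)) x" for w
    by (rule dir_deriv_cong[OF \<Omega> x hG])
  ultimately show ?thesis
    by (simp add: F_def g_def g1_def)
qed

section \<open>Vanishing of the second symmetric function and rank one\<close>

lemma hessian_defect_eigenframe:
  assumes "orthonormal_frame e" "\<And>a. hessian u x *v e a = l a *\<^sub>R e a"
  shows "hessian_defect u x = (\<Sum>a\<in>UNIV. l a)\<^sup>2 - (\<Sum>a\<in>UNIV. (l a)\<^sup>2)"
  by (simp add: hessian_defect_def frame_quadratic_eigen(1,2)[OF assms])

text \<open>In terms of the eigenvalues, the defect is \<open>(\<Sum> l\<^sub>a)\<^sup>2 - \<Sum> l\<^sub>a\<^sup>2\<close>, twice the sum of the products of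
  pairs of nonnegative numbers.\<close>

lemma psd_hessian_defect:
  assumes "positive_semidefinite (hessian u x)"
  shows "2 * sigma2 (hessian u x) = hessian_defect u x"
    and "0 \<le> hessian_defect u x"
    and "hessian_defect u x = 0 \<Longrightarrow> 0 < laplacian u x \<Longrightarrow> rank (hessian u x) = 1"
proof -
  obtain e l where e: "orthonormal_frame e" and l: "\<And>a. hessian u x *v e a = l a *\<^sub>R e a"
    using symmetric_matrix_eigenframe assms unfolding positive_semidefinite_def by metis
  note q = hessian_defect_eigenframe[OF e l]
  have l0: "0 \<le> l a" for a
    using frame_quadratic_eigen(3)[OF e l assms] .
  show "2 * sigma2 (hessian u x) = hessian_defect u x"
    using two_sigma2_eigenframe[OF e l] q by simp
  have "(\<Sum>a\<in>UNIV. (l a)\<^sup>2) \<le> (\<Sum>a\<in>UNIV. l a * sum l UNIV)"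
    unfolding power2_eq_square using l0 by (intro sum_mono mult_left_mono member_le_sum) auto
  also have "\<dots> = (sum l UNIV)\<^sup>2"
    by (simp add: power2_eq_square sum_distrib_right)
  finally show "0 \<le> hessian_defect u x" by (simp add: q)
  show "rank (hessian u x) = 1" if "hessian_defect u x = 0" "0 < laplacian u x"
    using that q frame_quadratic_eigen(1)[OF e l]
    by (intro rank_one_eigenframe[OF e l l0]) (auto simp: laplacian_def)
qed

text \<open>Near the minimum the zeroth-order term of the differential inequality may be dropped and the
  coefficient of the gradient bounded, so the strong minimum principle makes the defect constant
  there. Evaluating the full inequality for this constant \<open>c\<close> leaves \<open>0 \<le> 2 G' c\<close>, which with
  \<open>G' < 0\<close> and \<open>c \<ge> 0\<close> means \<open>c = 0\<close>.\<close>

lemma hessian_defect_zero_near_local_min: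
  fixes u :: "real^'n::finite \<Rightarrow> real"
  assumes \<Omega>: "open \<Omega>" and G: "smooth_on UNIV G" "\<And>t. 0 < G t" "\<And>t. deriv G t < 0"
    and A: "A \<le> 2" "\<And>t. G t * deriv (deriv G) t \<le> A * (deriv G t)\<^sup>2"
    and u: "smooth_on \<Omega> u" "\<And>x. x \<in> \<Omega> \<Longrightarrow> positive_semidefinite (hessian u x)"
      "\<And>x. x \<in> \<Omega> \<Longrightarrow> laplacian u x = G (u x)"
    and x0: "x0 \<in> \<Omega>" "\<forall>\<^sub>F x in at x0. hessian_defect u x0 \<le> hessian_defect u x"
  shows "\<forall>\<^sub>F x in nhds x0. hessian_defect u x = 0"
proof -
  let ?F = "hessian_defect u" and ?g = "\<lambda>y. G (u y)"
  have Fs: "smooth_on \<Omega> ?F" by (rule smooth_on_hessian_defect[OF \<Omega> u(1)])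
  obtain d1 where d1: "0 < d1" "cball x0 d1 \<subseteq> \<Omega>"
    using \<Omega> x0(1) open_contains_cball by blast
  obtain d2 where d2: "0 < d2" "\<And>x. dist x x0 < d2 \<Longrightarrow> ?F x0 \<le> ?F x"
    using x0(2) unfolding eventually_at by (metis UNIV_I order_refl)
  define r where "r = min d1 d2"
  have r: "0 < r" "cball x0 r \<subseteq> \<Omega>" "ball x0 r \<subseteq> \<Omega>"
    using d1 d2(1) by (auto simp: r_def)
  have min: "?F x0 \<le> ?F x" if "x \<in> ball x0 r" for x
    using that by (intro d2) (auto simp: r_def dist_commute)
  have gs: "smooth_on \<Omega> ?g"
  proof (rule smooth_on_cong[OF \<Omega>])
    show "smooth_on \<Omega> (\<lambda>y. \<Sum>i\<in>UNIV. dir_deriv (axis i 1) (dir_deriv (axis i 1) u) y)"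
      by (intro smooth_on_sum \<Omega> smooth_on_dir_deriv u)
    show "(\<Sum>i\<in>UNIV. dir_deriv (axis i 1) (dir_deriv (axis i 1) u) y) = ?g y" if "y \<in> \<Omega>" for y
      using u(3)[OF that] by (simp add: laplacian_def trace_def hessian_nth)
  qed
  define K where "K = (\<lambda>y. 6 * CARD('n) * norm (\<chi> k. dir_deriv (axis k 1) ?g y :: real^'n) / ?g y)"
  have "continuous_on \<Omega> K"
    unfolding K_def using G(2)
    by (intro continuous_intros smooth_on_continuous gs smooth_on_dir_deriv)
      (auto simp: less_imp_neq[symmetric])
  then have "continuous_on (cball x0 r) K"
    using r(2) continuous_on_subset by blast
  then obtain z where z: "\<forall>y\<in>cball x0 r. K y \<le> K z"
    using continuous_attains_sup[of "cball x0 r" K] r(1) by auto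
  have K0: "0 \<le> K y" for y
    using G(2)[of "u y"] by (simp add: K_def)
  have F0: "0 \<le> ?F x" if "x \<in> \<Omega>" for x
    using psd_hessian_defect(2) u(2)[OF that] by blast
  have ineq: "(\<Sum>k\<in>UNIV. dir_deriv (axis k 1) (dir_deriv (axis k 1) ?F) x)
      \<le> 2 * deriv G (u x) * ?F x + K x * norm (\<chi> k. dir_deriv (axis k 1) ?F x)" if "x \<in> \<Omega>" for x
    using laplacian_hessian_defect_le[OF \<Omega> G(1,2) A u that] by (simp add: K_def)
  have const: "?F y = ?F x0" if "y \<in> ball x0 (r / 3)" for y
  proof (rule strong_minimum_principle[where f = ?F and C = "K z", OF _ r(1) K0 _ min that])
    show "smooth_on (ball x0 r) ?F"
      by (rule smooth_on_subset[OF Fs r(3)])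
    show "(\<Sum>k\<in>UNIV. dir_deriv (axis k 1) (dir_deriv (axis k 1) ?F) x)
        \<le> K z * norm (\<chi> k. dir_deriv (axis k 1) ?F x)" if "x \<in> ball x0 r" for x
    proof -
      have x: "x \<in> \<Omega>" "x \<in> cball x0 r" using that r by auto
      have "2 * deriv G (u x) * ?F x \<le> 0"
        using G(3)[of "u x"] F0[OF x(1)] by (simp add: mult_nonpos_nonneg)
      moreover have "K x * norm (\<chi> k. dir_deriv (axis k 1) ?F x) \<le> K z * norm (\<chi> k. dir_deriv (axis k 1) ?F x)"
        by (intro mult_right_mono z[rule_format] x) auto
      ultimately show ?thesis using ineq[OF x(1)] by linarith
    qed
  qed auto
  let ?B = "ball x0 (r / 3)"
  have B: "x0 \<in> ?B" using r(1) by simp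
  have c1: "dir_deriv v ?F y = 0" if "y \<in> ?B" for v y
    using dir_deriv_cong[OF open_ball that const] by (simp add: dir_deriv_const)
  have c2: "dir_deriv v (dir_deriv w ?F) x0 = 0" for v w
    using dir_deriv_cong[OF open_ball B c1] by (simp add: dir_deriv_const)
  have "0 \<le> 2 * deriv G (u x0) * ?F x0"
    using ineq[OF x0(1)] by (simp add: c1[OF B] c2 vec_eq_iff[of "\<chi> k. 0" 0] norm_eq_zero[THEN iffD2])
  then have "?F x0 \<le> 0"
    using G(3)[of "u x0"] by (simp add: zero_le_mult_iff)
  then have "?F x0 = 0" using F0[OF x0(1)] by simp
  then show ?thesis
    unfolding eventually_nhds using B const by (intro exI[of _ ?B]) auto
qed

theorem theorem1p3:
  fixes \<Omega> :: "(real^'n::finite) set"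
    and A :: real
    and G :: "real \<Rightarrow> real"
    and u :: "real^'n \<Rightarrow> real"
  assumes "CARD('n) \<ge> 2"
    and "open \<Omega>" "connected \<Omega>" "\<Omega> \<noteq> {}"
    and "0 < A" "A \<le> 2"
    and "smooth_on UNIV G"
    and "\<And>t. G t > 0"
    and "\<And>t. deriv G t < 0"
    and "\<And>t. G t * deriv (deriv G) t \<le> A * (deriv G t)\<^sup>2"
    and "smooth_on \<Omega> u"
    and "\<And>x. x \<in> \<Omega> \<Longrightarrow> positive_semidefinite (hessian u x)"
    and "\<And>x. x \<in> \<Omega> \<Longrightarrow> laplacian u x = G (u x)"
    and "\<exists>x0\<in>\<Omega>. \<forall>\<^sub>F x in at x0 within \<Omega>. sigma2 (hessian u x0) \<le> sigma2 (hessian u x)"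
  shows "\<forall>x\<in>\<Omega>. rank (hessian u x) = 1"
proof -
  let ?F = "hessian_defect u" and ?Z = "{x \<in> \<Omega>. hessian_defect u x = 0}"
  have zero_near: "\<forall>\<^sub>F x in nhds z. ?F x = 0"
    if "z \<in> \<Omega>" "\<forall>\<^sub>F x in at z. ?F z \<le> ?F x" for z
    by (rule hessian_defect_zero_near_local_min[OF assms(2,7-9,6,10-13) that])
  obtain x0 where x0: "x0 \<in> \<Omega>"
    "\<forall>\<^sub>F x in at x0 within \<Omega>. sigma2 (hessian u x0) \<le> sigma2 (hessian u x)"
    using assms(14) by blast
  have "\<forall>\<^sub>F x in at x0. sigma2 (hessian u x0) \<le> sigma2 (hessian u x)"
    using x0(2) by (simp only: at_within_open[OF x0(1) assms(2)])
  then have "\<forall>\<^sub>F x in at x0. ?F x0 \<le> ?F x"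
    using eventually_at_in_open'[OF assms(2) x0(1)]
  proof eventually_elim
    case (elim x)
    then show ?case
      using psd_hessian_defect(1)[OF assms(12)[OF x0(1)]] psd_hessian_defect(1)[OF assms(12)[of x]]
      by linarith
  qed
  then have "?F x0 = 0"
    by (rule eventually_nhds_x_imp_x[OF zero_near[OF x0(1)]])
  then have ne: "x0 \<in> ?Z" using x0(1) by simp
  have "open ?Z"
    unfolding open_dist
  proof safe
    fix x assume x: "x \<in> \<Omega>" "?F x = 0"
    have "\<forall>\<^sub>F y in at x. ?F x \<le> ?F y"
      using eventually_at_in_open'[OF assms(2) x(1)]
      by (rule eventually_mono) (use psd_hessian_defect(2)[OF assms(12)] x(2) in simp)
    then have "\<forall>\<^sub>F y in nhds x. ?F y = 0 \<and> y \<in> \<Omega>"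
      by (intro eventually_conj zero_near x(1) eventually_nhds_in_open[OF assms(2) x(1)])
    then show "\<exists>e>0. \<forall>y. dist y x < e \<longrightarrow> y \<in> ?Z"
      by (simp add: eventually_nhds_metric conj_commute)
  qed
  then have "openin (top_of_set \<Omega>) ?Z"
    by (simp add: openin_open_eq assms(2))
  moreover have "closedin (top_of_set \<Omega>) ?Z"
    using continuous_closedin_preimage_constant
      [OF smooth_on_continuous[OF smooth_on_hessian_defect[OF assms(2,11)]]] .
  ultimately have "?Z = \<Omega>"
    using assms(3) ne unfolding connected_clopen by blast
  show ?thesis
  proof
    fix x assume x: "x \<in> \<Omega>"
    then have "?F x = 0" using \<open>?Z = \<Omega>\<close> by blast
    then show "rank (hessian u x) = 1"
      using psd_hessian_defect(3)[OF assms(12)[OF x]] assms(8) by (simp add: assms(13)[OF x])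
  qed
qed

end
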